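(* Let $n\ge 2$, $a_1,\ldots,a_{n-1}$ positive integers and $\lambda=\sum a_i\omega_i$. Every simple vertex of $P_\lambda$ is of the form $x(E)$ for some $E\subset R$. For $E\subset R$, the point $x(E)$ is a simple vertex of $P_\lambda$ if and only if for any two segments in $E$ with nonempty intersection, this intersection coincides with one of the two segments.
   Context: Let $U=\mathbb R^{\binom n2}$ with coordinates $x_{i,j}$, $1\le i<j\le n$. A Dyck path is a sequence $d=((i_1,j_1),\ldots,(i_N,j_N))$ of pairs with $1\le i_k<j_k\le n$, $j_1-i_1=j_N-i_N=1$, and each $(i_{k+1},j_{k+1})$ equal to $(i_k+1,j_k)$ or $(i_k,j_k+1)$. Put $S(x,d)=\sum_{(i,j)\in d}x_{i,j}$ and $M(\lambda,d)=a_{i_1}+a_{i_1+1}+\ldots+a_{i_N}$. The FFLV polytope is $P_\lambda=\{x\in U: x\ge 0,\ S(x,d)\le M(\lambda,d)\ \forall d\}$. A vertex of a polytope is simple if the tangent cone of the polytope at it is simplicial and unimodular. Let $R$ be the set of segments $[i,j]$ with integers $1\le i<j\le n$. For $i<j$ let $d^{i,j}=((i,i+1),\ldots,(i,j),(i+1,j),\ldots,(j-1,j))$. For $E\subset R$, $x(E)\in U$ is the unique point with $x(E)_{i,j}=0$ if $[i,j]\notin E$ and $S(x(E),d^{i,j})=a_i+\ldots+a_{j-1}$ if $[i,j]\in E$. *)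

theory Defs
  imports "HOL-Analysis.Analysis" "HOL-Analysis.Finite_Function_Topology"
begin

text \<open>The segment \<open>[i,j]\<close> and the coordinate index \<open>(i,j)\<close> are both encoded by the pair
  \<open>(i,j)\<close>. Points of \<open>\<real>^(n choose 2)\<close> are finitely supported functions on
  pairs whose support consists of such pairs with \<open>1 \<le> i < j \<le> n\<close>.\<close>

definition segments :: "nat \<Rightarrow> (nat \<times> nat) set" where
  "segments n = {(i, j). 1 \<le> i \<and> i < j \<and> j \<le> n}"

definition segment :: "nat \<times> nat \<Rightarrow> real set" where
  "segment s = {real (fst s)..real (snd s)}"

type_synonym point = "nat \<times> nat \<Rightarrow>\<^sub>0 real"

definition coord_space :: "nat \<Rightarrow> point set" where
  "coord_space n = {x. Poly_Mapping.keys x \<subseteq> segments n}"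

definition integer_lattice :: "nat \<Rightarrow> point set" where
  "integer_lattice n = {x \<in> coord_space n. \<forall>s. Poly_Mapping.lookup x s \<in> \<int>}"

definition dyck_path :: "nat \<Rightarrow> (nat \<times> nat) list \<Rightarrow> bool" where
  "dyck_path n d \<longleftrightarrow>
     d \<noteq> [] \<and> set d \<subseteq> segments n \<and>
     snd (hd d) = fst (hd d) + 1 \<and> snd (last d) = fst (last d) + 1 \<and>
     (\<forall>k. Suc k < length d \<longrightarrow>
        d ! Suc k = (fst (d ! k) + 1, snd (d ! k)) \<or>
        d ! Suc k = (fst (d ! k), snd (d ! k) + 1))"

definition path_sum :: "point \<Rightarrow> (nat \<times> nat) list \<Rightarrow> real" where
  "path_sum x d = (\<Sum>s\<leftarrow>d. Poly_Mapping.lookup x s)"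

text \<open>The weight \<open>\<lambda> = \<Sum> a\<^sub>i \<omega>\<^sub>i\<close> enters only through its coefficients
  \<open>a\<^sub>1, \<dots>, a\<^sub>n\<^sub>-\<^sub>1\<close>; other values of \<open>a\<close> are never used.\<close>

definition path_bound :: "(nat \<Rightarrow> nat) \<Rightarrow> (nat \<times> nat) list \<Rightarrow> real" where
  "path_bound a d = (\<Sum>k = fst (hd d)..fst (last d). real (a k))"

definition FFLV :: "nat \<Rightarrow> (nat \<Rightarrow> nat) \<Rightarrow> point set" where
  "FFLV n a =
     {x \<in> coord_space n.
        (\<forall>s \<in> segments n. 0 \<le> Poly_Mapping.lookup x s) \<and>
        (\<forall>d. dyck_path n d \<longrightarrow> path_sum x d \<le> path_bound a d)}"

text \<open>The tangent cone is taken with apex at the origin. For a polytope, the cone of feasible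
  directions is already closed.\<close>

definition tangent_cone :: "'a::real_vector set \<Rightarrow> 'a \<Rightarrow> 'a set" where
  "tangent_cone P v = conic hull ((\<lambda>y. y - v) ` P)"

definition simplicial_cone :: "'a::real_vector set \<Rightarrow> bool" where
  "simplicial_cone C \<longleftrightarrow> (\<exists>B. finite B \<and> independent B \<and> C = convex_cone hull B)"

text \<open>A cone is unimodular with respect to the lattice \<open>L\<close> if it is generated by a
  lattice basis of the part of \<open>L\<close> in its linear span.\<close>

definition unimodular_cone :: "'a::real_vector set \<Rightarrow> 'a set \<Rightarrow> bool" where
  "unimodular_cone L C \<longleftrightarrow>
     (\<exists>B. finite B \<and> independent B \<and> C = convex_cone hull B \<and>
        L \<inter> span C = {(\<Sum>b\<in>B. of_int (c b) *\<^sub>R b) |c :: 'a \<Rightarrow> int. True})"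

definition simple_vertex :: "'a::real_vector set \<Rightarrow> 'a set \<Rightarrow> 'a \<Rightarrow> bool" where
  "simple_vertex L P v \<longleftrightarrow>
     v extreme_point_of P \<and>
     simplicial_cone (tangent_cone P v) \<and> unimodular_cone L (tangent_cone P v)"

definition hook :: "nat \<Rightarrow> nat \<Rightarrow> (nat \<times> nat) list" where
  "hook i j = map (\<lambda>k. (i, k)) [i + 1..<j + 1] @ map (\<lambda>k. (k, j)) [i + 1..<j]"

definition is_segment_point ::
    "nat \<Rightarrow> (nat \<Rightarrow> nat) \<Rightarrow> (nat \<times> nat) set \<Rightarrow> point \<Rightarrow> bool" where
  "is_segment_point n a E x \<longleftrightarrow>
     x \<in> coord_space n \<and>
     (\<forall>(i, j) \<in> segments n.
        ((i, j) \<notin> E \<longrightarrow> Poly_Mapping.lookup x (i, j) = 0) \<and>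
        ((i, j) \<in> E \<longrightarrow> path_sum x (hook i j) = (\<Sum>k = i..<j. real (a k))))"

definition segment_point :: "nat \<Rightarrow> (nat \<Rightarrow> nat) \<Rightarrow> (nat \<times> nat) set \<Rightarrow> point" where
  "segment_point n a E = (THE x. is_segment_point n a E x)"

lemma path_sum_hook:
  assumes "i < j"
  shows "path_sum x (hook i j) =
    Poly_Mapping.lookup x (i, j) + (\<Sum>k = i + 1..<j. Poly_Mapping.lookup x (i, k))
      + (\<Sum>k = i + 1..<j. Poly_Mapping.lookup x (k, j))"
  using assms
  by (simp add: path_sum_def hook_def o_def interv_sum_list_conv_sum_set_nat)

function hook_coord :: "(nat \<Rightarrow> nat) \<Rightarrow> (nat \<times> nat) set \<Rightarrow> nat \<Rightarrow> nat \<Rightarrow> real" where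
  "hook_coord a E i j =
     (if (i, j) \<in> E
      then (\<Sum>k = i..<j. real (a k)) - (\<Sum>k = i + 1..<j. hook_coord a E i k)
             - (\<Sum>k = i + 1..<j. hook_coord a E k j)
      else 0)"
  by auto
termination
  by (relation "Wellfounded.measure (\<lambda>(a, E, i, j). j - i)") auto

declare hook_coord.simps [simp del]

lemma finite_segments [simp]: "finite (segments n)"
  by (rule finite_subset[of _ "{..n} \<times> {..n}"]) (auto simp: segments_def)

lemma is_segment_point_ex1: "\<exists>!x. is_segment_point n a E x"
proof (rule ex_ex1I)
  define f where "f = (\<lambda>s. if s \<in> segments n then hook_coord a E (fst s) (snd s) else 0)"
  have fin: "finite {s. f s \<noteq> 0}"
    by (rule finite_subset[OF _ finite_segments[of n]]) (auto simp: f_def)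
  define x where "x = Abs_poly_mapping f"
  have lx: "Poly_Mapping.lookup x = f"
    unfolding x_def using fin by simp
  have "is_segment_point n a E x"
    unfolding is_segment_point_def
  proof (intro conjI ballI)
    show "x \<in> coord_space n"
      by (auto simp: coord_space_def in_keys_iff lx f_def split: if_splits)
  next
    fix s assume s: "s \<in> segments n"
    obtain i j where ij: "s = (i, j)" by fastforce
    have b: "1 \<le> i" "i < j" "j \<le> n" using s ij by (auto simp: segments_def)
    have 1: "(\<Sum>k = i + 1..<j. f (i, k)) = (\<Sum>k = i + 1..<j. hook_coord a E i k)"
      by (rule sum.cong) (use b in \<open>auto simp: f_def segments_def\<close>)
    have 2: "(\<Sum>k = i + 1..<j. f (k, j)) = (\<Sum>k = i + 1..<j. hook_coord a E k j)"
      by (rule sum.cong) (use b in \<open>auto simp: f_def segments_def\<close>)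
    have 3: "f (i, j) = hook_coord a E i j" using s ij by (simp add: f_def)
    show "case s of (i, j) \<Rightarrow>
        ((i, j) \<notin> E \<longrightarrow> Poly_Mapping.lookup x (i, j) = 0) \<and>
        ((i, j) \<in> E \<longrightarrow> path_sum x (hook i j) = (\<Sum>k = i..<j. real (a k)))"
      unfolding ij prod.case path_sum_hook[OF b(2)] lx 1 2 3
      by (subst (1 2) hook_coord.simps) auto
  qed
  then show "\<exists>x. is_segment_point n a E x" ..
next
  fix x y assume x: "is_segment_point n a E x" and y: "is_segment_point n a E y"
  have out: "Poly_Mapping.lookup z s = 0"
    if "is_segment_point n a E z" "s \<notin> segments n" for z s
    using that by (auto simp: is_segment_point_def coord_space_def in_keys_iff)
  have ins: "Poly_Mapping.lookup x (i, j) = Poly_Mapping.lookup y (i, j)"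
    if "(i, j) \<in> segments n" for i j
    using that
  proof (induction "j - i" arbitrary: i j rule: less_induct)
    case less
    then have b: "1 \<le> i" "i < j" "j \<le> n" by (auto simp: segments_def)
    have 1: "(\<Sum>k = i + 1..<j. Poly_Mapping.lookup x (i, k)) =
             (\<Sum>k = i + 1..<j. Poly_Mapping.lookup y (i, k))"
      by (rule sum.cong[OF refl], rule less.hyps) (use b in \<open>auto simp: segments_def\<close>)
    have 2: "(\<Sum>k = i + 1..<j. Poly_Mapping.lookup x (k, j)) =
             (\<Sum>k = i + 1..<j. Poly_Mapping.lookup y (k, j))"
      by (rule sum.cong[OF refl], rule less.hyps) (use b in \<open>auto simp: segments_def\<close>)
    show ?case
    proof (cases "(i, j) \<in> E")
      case True
      have "path_sum x (hook i j) = path_sum y (hook i j)"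
        using x y less.prems True by (fastforce simp: is_segment_point_def)
      then show ?thesis using 1 2 by (simp add: path_sum_hook[OF b(2)])
    next
      case False
      then show ?thesis using x y less.prems by (fastforce simp: is_segment_point_def)
    qed
  qed
  show "x = y"
  proof (rule poly_mapping_eqI)
    fix s :: "nat \<times> nat"
    show "Poly_Mapping.lookup x s = Poly_Mapping.lookup y s"
      using ins[of "fst s" "snd s"] out[OF x, of s] out[OF y, of s]
      by (cases "s \<in> segments n") auto
  qed
qed

lemma segment_point_spec: "is_segment_point n a E (segment_point n a E)"
  unfolding segment_point_def by (rule theI'[OF is_segment_point_ex1])

end

theory Submission
  imports Defs
begin

text \<open>
  If the tangent cone at \<open>v\<close> is simplicial, choose one active inequality for each of its facets.
  The facet functionals are the extreme rays of a simplicial cone containing all active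
  functionals; hence, if the sum of two facet functionals is also the sum of two active ones, the
  latter lie in the span of the former. All inequalities \<open>x\<^sub>s \<ge> 0\<close> with \<open>v\<^sub>s = 0\<close> support facets.
  Exchanging the tails of two paths at a common cell gives such a relation, and it shows that two
  facet paths never cross; flipping a corner gives another one, and it shows that \<open>v\<close> does not
  vanish at the corners of facet paths. A weighting of noncrossing paths whose total vanishes at
  every outer corner vanishes at every cell. As facet paths are linearly independent, there are at
  least as many outer corners as facet paths, and by dimension at least as many facet paths as
  cells in the support \<open>E\<close> of \<open>v\<close>. Thus every cell of \<open>E\<close> is an outer corner of a facet path. As
  paths do not cross, it is an inner corner of none, so the facet paths are the hooks \<open>d\<^bsup>i,j\<^esup>\<close> with
  \<open>[i, j] \<in> E\<close>. Hence \<open>v = x(E)\<close>, and \<open>E\<close> is laminar.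

  Conversely, if \<open>E\<close> is laminar, the values of \<open>x(E)\<close> along a chain of cells inside \<open>[i, j]\<close> that
  avoids \<open>(i, j)\<close> sum to less than \<open>a\<^sub>i + \<dots> + a\<^bsub>j-1\<^esub>\<close>. So \<open>x(E)\<close> is positive on \<open>E\<close>, lies in the
  polytope, and its tight paths are exactly the hooks of \<open>E\<close>. In particular \<open>E\<close> can be recovered
  from \<open>x(E)\<close>. The active functionals form a triangular system with diagonal entries \<open>\<plusminus>1\<close>, ordered
  by \<open>j - i\<close>, so that the tangent cone is simplicial and unimodular.
\<close>

section \<open>Homogeneous linear systems\<close>

lemma lookup_scaleR [simp]:
  fixes x :: "'a \<Rightarrow>\<^sub>0 'b::real_vector"
  shows "Poly_Mapping.lookup (r *\<^sub>R x) s = r *\<^sub>R Poly_Mapping.lookup x s"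
proof -
  have "finite {i. r *\<^sub>R Poly_Mapping.lookup x i \<noteq> 0}"
    by (rule finite_subset[OF _ finite_keys[of x]]) (auto simp: in_keys_iff)
  then show ?thesis
    by (simp add: scaleR_poly_mapping_def)
qed

lemma lookup_sum_singles:
  fixes c :: "'a \<Rightarrow> real"
  assumes "finite J"
  shows "Poly_Mapping.lookup (\<Sum>j\<in>J. c j *\<^sub>R Poly_Mapping.single j 1) k = (if k \<in> J then c k else 0)"
  using assms by (simp add: lookup_sum lookup_single when_def if_distrib cong: if_cong)

lemma card_le_if_trivial_kernel:
  fixes A :: "'i \<Rightarrow> 'j \<Rightarrow> real"
  assumes finite: "finite I" "finite J"
    and kernel: "\<And>x i. (\<And>j. j \<in> J \<Longrightarrow> (\<Sum>i\<in>I. x i * A i j) = 0) \<Longrightarrow> i \<in> I \<Longrightarrow> x i = 0"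
  shows "card I \<le> card J"
proof -
  define e :: "'j \<Rightarrow> 'j \<Rightarrow>\<^sub>0 real" where "e j = Poly_Mapping.single j 1" for j
  define row where "row i = (\<Sum>j\<in>J. A i j *\<^sub>R e j)" for i
  have row: "(\<Sum>i\<in>I. x i *\<^sub>R row i) = (\<Sum>j\<in>J. (\<Sum>i\<in>I. x i * A i j) *\<^sub>R e j)" for x
    unfolding row_def scaleR_sum_right scaleR_sum_left by (subst sum.swap) simp
  have no_relation: "x i = 0" if zero: "(\<Sum>i\<in>I. x i *\<^sub>R row i) = 0" and i: "i \<in> I" for x i
  proof (rule kernel[OF _ i])
    show "(\<Sum>i\<in>I. x i * A i j) = 0" if "j \<in> J" for j
      using zero that lookup_sum_singles[OF finite(2), of "\<lambda>j. \<Sum>i\<in>I. x i * A i j" j]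
      by (simp add: row e_def)
  qed
  have inj: "inj_on row I"
  proof (rule inj_onI, rule ccontr)
    fix i k assume ik: "i \<in> I" "k \<in> I" "row i = row k" "i \<noteq> k"
    define x where "x = (\<lambda>_. 0 :: real)(i := 1, k := - 1)"
    have "(\<Sum>l\<in>I. x l *\<^sub>R row l) = (\<Sum>l\<in>{i, k}. x l *\<^sub>R row l)"
      using finite(1) ik by (intro sum.mono_neutral_right) (auto simp: x_def)
    then show False
      using no_relation[of x i] ik by (simp add: x_def)
  qed
  have "independent (row ` I)"
    by (rule independent_if_scalars_zero)
      (use no_relation finite(1) in \<open>auto simp: sum.reindex[OF inj]\<close>)
  moreover have "row ` I \<subseteq> span (e ` J)"
    unfolding row_def by (intro image_subsetI span_sum span_scale span_base imageI)
  ultimately have "card (row ` I) \<le> card (e ` J)"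
    using independent_span_bound finite(2) by blast
  also have "\<dots> \<le> card J"
    by (rule card_image_le[OF finite(2)])
  finally show ?thesis
    by (simp add: card_image[OF inj])
qed

section \<open>Simplicial cones\<close>

lemma convex_cone_nonneg_combination:
  assumes "convex_cone C" "\<And>b. b \<in> A \<Longrightarrow> b \<in> C" "\<And>b. b \<in> A \<Longrightarrow> 0 \<le> k b"
  shows "(\<Sum>b\<in>A. k b *\<^sub>R b) \<in> C"
  using assms(2,3)
proof (induction A rule: infinite_finite_induct)
  case (insert b A)
  then show ?case
    using assms(1) by (simp add: convex_cone_add convex_cone_scaleR)
qed (use assms(1) in \<open>simp_all add: convex_cone_contains_0\<close>)

lemma convex_cone_hull_finite:
  fixes B :: "'a::real_vector set"
  assumes "finite B"
  shows "convex_cone hull B = {(\<Sum>b\<in>B. k b *\<^sub>R b) |k. \<forall>b\<in>B. 0 \<le> k b}" (is "_ = ?C")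
proof (rule hull_unique)
  show "B \<subseteq> ?C"
  proof
    fix b assume "b \<in> B"
    then have "b = (\<Sum>x\<in>B. of_bool (x = b) *\<^sub>R x)"
      using assms by (simp add: of_bool_def if_distrib[of "\<lambda>k. k *\<^sub>R _"] cong: if_cong)
    then show "b \<in> ?C"
      by (intro CollectI exI[of _ "\<lambda>x. of_bool (x = b)"]) simp
  qed
  show "convex_cone ?C"
    unfolding convex_cone_iff
  proof (intro conjI ballI allI impI)
    show "0 \<in> ?C"
      by (intro CollectI exI[of _ "\<lambda>_. 0"]) simp
  next
    fix x y assume "x \<in> ?C" "y \<in> ?C"
    then obtain k l where "x = (\<Sum>b\<in>B. k b *\<^sub>R b)" "y = (\<Sum>b\<in>B. l b *\<^sub>R b)"
      "\<forall>b\<in>B. 0 \<le> k b" "\<forall>b\<in>B. 0 \<le> l b" by blast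
    then show "x + y \<in> ?C"
      by (intro CollectI exI[of _ "\<lambda>b. k b + l b"]) (simp add: scaleR_add_left sum.distrib)
  next
    fix x and c :: real assume "x \<in> ?C" "0 \<le> c"
    then obtain k where "x = (\<Sum>b\<in>B. k b *\<^sub>R b)" "\<forall>b\<in>B. 0 \<le> k b" by blast
    with \<open>0 \<le> c\<close> show "c *\<^sub>R x \<in> ?C"
      by (intro CollectI exI[of _ "\<lambda>b. c * k b"]) (simp add: scaleR_sum_right)
  qed
qed (use convex_cone_nonneg_combination in blast)

lemma diff_notin_convex_cone_hull:
  assumes B: "finite B" "independent B" and b: "b \<in> B" and p: "p \<in> span (B - {b})"
  shows "p - b \<notin> convex_cone hull B"
proof
  assume "p - b \<in> convex_cone hull B"
  then obtain k where k: "p - b = (\<Sum>x\<in>B. k x *\<^sub>R x)" "\<forall>x\<in>B. 0 \<le> k x"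
    unfolding convex_cone_hull_finite[OF B(1)] by blast
  have "(k b + 1) *\<^sub>R b = p - (\<Sum>x\<in>B - {b}. k x *\<^sub>R x)"
    using k(1) B(1) b by (simp add: sum.remove[of B b] algebra_simps)
  also have "\<dots> \<in> span (B - {b})"
    by (intro span_diff[OF p] span_sum span_scale span_base)
  finally have "(k b + 1) *\<^sub>R b \<in> span (B - {b})" .
  from span_scale[OF this, of "1 / (k b + 1)"] have "b \<in> span (B - {b})"
    using k(2) b by (simp add: add_nonneg_eq_0_iff)
  then show False
    using B(2) b by (auto simp: dependent_def)
qed

lemma span_convex_cone_hull: "span (convex_cone hull B) = span B"
proof (rule subset_antisym)
  have "convex_cone hull B \<subseteq> span B"
    by (rule hull_minimal) (auto simp: convex_cone_span span_base)
  then show "span (convex_cone hull B) \<subseteq> span B"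
    by (rule span_minimal[OF _ subspace_span])
  show "span B \<subseteq> span (convex_cone hull B)"
    by (intro span_mono hull_subset)
qed

lemma simplicial_cone_pointed:
  assumes "simplicial_cone C" "u \<in> C" "- u \<in> C"
  shows "u = 0"
proof -
  obtain B where B: "finite B" "independent B" "C = convex_cone hull B"
    using assms(1) by (auto simp: simplicial_cone_def)
  obtain k l where k: "u = (\<Sum>b\<in>B. k b *\<^sub>R b)" "\<forall>b\<in>B. 0 \<le> k b"
    and l: "- u = (\<Sum>b\<in>B. l b *\<^sub>R b)" "\<forall>b\<in>B. 0 \<le> l b"
    using assms(2,3) unfolding B(3) convex_cone_hull_finite[OF B(1)] by blast
  have "(\<Sum>b\<in>B. (k b + l b) *\<^sub>R b) = u + - u"
    by (simp only: scaleR_add_left sum.distrib flip: k(1) l(1))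
  then have "k b + l b = 0" if "b \<in> B" for b
    using independentD[OF B(2,1) subset_refl _ that, of "\<lambda>b. k b + l b"] by simp
  then have "k b = 0" if "b \<in> B" for b
    using k(2) l(2) that by (meson add_nonneg_eq_0_iff)
  then show ?thesis
    using k(1) by simp
qed

lemma scaleR_diff_in_tangent_cone: "y \<in> P \<Longrightarrow> 0 \<le> c \<Longrightarrow> c *\<^sub>R (y - v) \<in> tangent_cone P v"
  unfolding tangent_cone_def conic_hull_explicit by blast

lemma extreme_point_if_tangent_cone_pointed:
  assumes "v \<in> P"
    and pointed: "\<And>u. u \<in> tangent_cone P v \<Longrightarrow> - u \<in> tangent_cone P v \<Longrightarrow> u = 0"
  shows "v extreme_point_of P"
  unfolding extreme_point_of_def
proof (intro conjI ballI notI)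
  fix x y assume xy: "x \<in> P" "y \<in> P" and "v \<in> open_segment x y"
  then obtain t where t: "x \<noteq> y" "0 < t" "t < 1" "v = (1 - t) *\<^sub>R x + t *\<^sub>R y"
    by (auto simp: in_segment)
  have "x - v = t *\<^sub>R (x - y)" "y - v = (1 - t) *\<^sub>R (y - x)"
    unfolding t(4) by (simp_all add: algebra_simps)
  then have "x - y = (1 / t) *\<^sub>R (x - v)" "- (x - y) = (1 / (1 - t)) *\<^sub>R (y - v)"
    using t(2,3) by simp_all
  then have "x - y = 0"
    using xy t(2,3) by (intro pointed) (simp_all only:, auto intro!: scaleR_diff_in_tangent_cone)
  then show False
    using t(1) by simp
qed (rule assms(1))

lemma simple_vertex_iff:
  "simple_vertex L P v \<longleftrightarrow> v \<in> P \<and> unimodular_cone L (tangent_cone P v)"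
proof
  assume "v \<in> P \<and> unimodular_cone L (tangent_cone P v)"
  moreover from this have "simplicial_cone (tangent_cone P v)"
    unfolding unimodular_cone_def simplicial_cone_def by blast
  ultimately show "simple_vertex L P v"
    unfolding simple_vertex_def
    using extreme_point_if_tangent_cone_pointed simplicial_cone_pointed by blast
qed (simp add: simple_vertex_def extreme_point_of_def)

locale dual_basis =
  fixes U :: "'a::real_vector set" and S :: "'s set" and \<phi> :: "'s \<Rightarrow> 'a \<Rightarrow> real" and b :: "'s \<Rightarrow> 'a"
  assumes subspace_U: "subspace U" and finite_S: "finite S"
    and linear: "\<And>s. s \<in> S \<Longrightarrow> linear (\<phi> s)"
    and b_in_U: "\<And>s. s \<in> S \<Longrightarrow> b s \<in> U"
    and dual: "\<And>s t. s \<in> S \<Longrightarrow> t \<in> S \<Longrightarrow> \<phi> t (b s) = of_bool (s = t)"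
    and separating: "\<And>u. u \<in> U \<Longrightarrow> (\<And>s. s \<in> S \<Longrightarrow> \<phi> s u = 0) \<Longrightarrow> u = 0"
begin

lemma combination_in_U: "(\<Sum>s\<in>S. k s *\<^sub>R b s) \<in> U"
  using subspace_U b_in_U by (intro subspace_sum subspace_scale) auto

lemma functional_of_combination: "t \<in> S \<Longrightarrow> \<phi> t (\<Sum>s\<in>S. k s *\<^sub>R b s) = k t"
  using finite_S linear
  by (simp add: linear_sum linear_scale dual of_bool_def if_distrib cong: if_cong)

lemma expansion:
  assumes "u \<in> U"
  shows "u = (\<Sum>s\<in>S. \<phi> s u *\<^sub>R b s)"
proof -
  have "\<phi> t (u - (\<Sum>s\<in>S. \<phi> s u *\<^sub>R b s)) = 0" if "t \<in> S" for t
    using that linear by (simp add: linear_diff functional_of_combination)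
  then have "u - (\<Sum>s\<in>S. \<phi> s u *\<^sub>R b s) = 0"
    using subspace_diff[OF subspace_U assms combination_in_U] by (rule separating[rotated])
  then show ?thesis by simp
qed

lemma inj_on_basis: "inj_on b S"
  by (rule inj_onI) (metis dual of_bool_eq(2) of_bool_eq_0_iff zero_neq_one)

lemma independent_basis: "independent (b ` S)"
proof (rule independent_if_scalars_zero)
  fix k x assume zero: "(\<Sum>x\<in>b ` S. k x *\<^sub>R x) = 0" and "x \<in> b ` S"
  then obtain t where t: "t \<in> S" "x = b t" by blast
  have "k (b t) = \<phi> t (\<Sum>x\<in>b ` S. k x *\<^sub>R x)"
    by (simp add: sum.reindex[OF inj_on_basis] functional_of_combination[OF t(1)])
  then show "k x = 0"
    using zero t linear by (simp add: linear_0)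
qed (simp add: finite_S)

lemma combinations_of_basis_eq:
  "{(\<Sum>x\<in>b ` S. k x *\<^sub>R x) |k. \<forall>x\<in>b ` S. P (k x)} = {u \<in> U. \<forall>s\<in>S. P (\<phi> s u)}"
proof (intro subset_antisym subsetI)
  fix u assume "u \<in> {(\<Sum>x\<in>b ` S. k x *\<^sub>R x) |k. \<forall>x\<in>b ` S. P (k x)}"
  then obtain k where k: "u = (\<Sum>x\<in>b ` S. k x *\<^sub>R x)" "\<forall>x\<in>b ` S. P (k x)" by blast
  then have "u = (\<Sum>s\<in>S. k (b s) *\<^sub>R b s)"
    by (simp add: sum.reindex[OF inj_on_basis])
  then show "u \<in> {u \<in> U. \<forall>s\<in>S. P (\<phi> s u)}"
    using k(2) by (simp add: combination_in_U functional_of_combination)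
next
  fix u assume u: "u \<in> {u \<in> U. \<forall>s\<in>S. P (\<phi> s u)}"
  define k where "k x = \<phi> (the_inv_into S b x) u" for x
  have "u = (\<Sum>x\<in>b ` S. k x *\<^sub>R x)"
    using expansion[of u] u
    by (simp add: sum.reindex[OF inj_on_basis] k_def the_inv_into_f_f[OF inj_on_basis])
  moreover have "\<forall>x\<in>b ` S. P (k x)"
    using u by (simp add: k_def the_inv_into_f_f[OF inj_on_basis])
  ultimately show "u \<in> {(\<Sum>x\<in>b ` S. k x *\<^sub>R x) |k. \<forall>x\<in>b ` S. P (k x)}" by blast
qed

lemma nonneg_cone_eq: "{u \<in> U. \<forall>s\<in>S. 0 \<le> \<phi> s u} = convex_cone hull (b ` S)"
  unfolding convex_cone_hull_finite[OF finite_imageI[OF finite_S]] combinations_of_basis_eq ..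

lemma lattice_eq: "{u \<in> U. \<forall>s\<in>S. \<phi> s u \<in> \<int>} = {(\<Sum>x\<in>b ` S. of_int (k x) *\<^sub>R x) |k :: 'a \<Rightarrow> int. True}"
  unfolding combinations_of_basis_eq[of "\<lambda>r. r \<in> \<int>", symmetric]
proof (intro subset_antisym subsetI)
  fix u assume "u \<in> {(\<Sum>x\<in>b ` S. k x *\<^sub>R x) |k. \<forall>x\<in>b ` S. k x \<in> \<int>}"
  then obtain k where k: "u = (\<Sum>x\<in>b ` S. k x *\<^sub>R x)" "\<forall>x\<in>b ` S. k x \<in> \<int>" by blast
  have "u = (\<Sum>x\<in>b ` S. of_int \<lfloor>k x\<rfloor> *\<^sub>R x)"
    unfolding k(1) using k(2) by (intro sum.cong) (auto elim: Ints_cases)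
  then show "u \<in> {(\<Sum>x\<in>b ` S. of_int (k x) *\<^sub>R x) |k :: 'a \<Rightarrow> int. True}"
    by (intro CollectI exI[of _ "\<lambda>x. \<lfloor>k x\<rfloor>"]) simp
next
  fix u assume "u \<in> {(\<Sum>x\<in>b ` S. of_int (k x) *\<^sub>R x) |k :: 'a \<Rightarrow> int. True}"
  then obtain k :: "'a \<Rightarrow> int" where "u = (\<Sum>x\<in>b ` S. of_int (k x) *\<^sub>R x)" by blast
  then show "u \<in> {(\<Sum>x\<in>b ` S. k x *\<^sub>R x) |k. \<forall>x\<in>b ` S. k x \<in> \<int>}"
    by (intro CollectI exI[of _ "\<lambda>x. of_int (k x)"]) simp
qed

lemma span_basis: "span (b ` S) = U"
  using combinations_of_basis_eq[of "\<lambda>_. True"] by (auto simp: span_finite finite_S)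

lemma unimodular_nonneg_cone: "unimodular_cone {u \<in> U. \<forall>s\<in>S. \<phi> s u \<in> \<int>} {u \<in> U. \<forall>s\<in>S. 0 \<le> \<phi> s u}"
  unfolding unimodular_cone_def
proof (intro exI conjI)
  show "{u \<in> U. \<forall>s\<in>S. \<phi> s u \<in> \<int>} \<inter> span {u \<in> U. \<forall>s\<in>S. 0 \<le> \<phi> s u}
      = {(\<Sum>x\<in>b ` S. of_int (k x) *\<^sub>R x) |k :: 'a \<Rightarrow> int. True}"
    unfolding nonneg_cone_eq span_convex_cone_hull span_basis lattice_eq[symmetric] by blast
qed (simp_all add: finite_S independent_basis nonneg_cone_eq)

end

section \<open>Polyhedral cones\<close>

lemma finite_common_multiplier:
  fixes p q :: "'i \<Rightarrow> real"
  assumes "finite I" "\<And>i. i \<in> I \<Longrightarrow> 0 \<le> q i" "\<And>i. i \<in> I \<Longrightarrow> q i = 0 \<Longrightarrow> p i \<le> 0"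
  shows "\<exists>K>0. \<forall>i\<in>I. p i \<le> K * q i"
proof -
  have "\<forall>\<^sub>F K in at_top. p i \<le> K * q i" if "i \<in> I" for i
  proof (cases "q i = 0")
    case False
    then have "0 < q i"
      using assms(2) that by (simp add: less_le)
    then show ?thesis
      by (intro eventually_mono[OF eventually_ge_at_top[of "p i / q i"]]) (simp add: divide_le_eq)
  qed (use assms(3) that in simp)
  then have "\<forall>\<^sub>F K in at_top. 0 < K \<and> (\<forall>i\<in>I. p i \<le> K * q i)"
    using eventually_gt_at_top[of 0] assms(1) by (intro eventually_conj eventually_ball_finite) auto
  then show ?thesis
    using eventually_happens'[OF trivial_limit_at_top_linorder] by blast
qed

lemma tangent_cone_polyhedron:
  fixes \<phi> :: "'i \<Rightarrow> 'a::real_vector \<Rightarrow> real"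
  assumes subspace: "subspace U" and finite: "finite I" and linear: "\<And>i. i \<in> I \<Longrightarrow> linear (\<phi> i)"
    and P_eq: "P = {x \<in> U. \<forall>i\<in>I. r i \<le> \<phi> i x}" and v_in_P: "v \<in> P"
  shows "tangent_cone P v = {u \<in> U. \<forall>i\<in>I. \<phi> i v = r i \<longrightarrow> 0 \<le> \<phi> i u}"
proof (intro subset_antisym subsetI)
  fix u assume "u \<in> tangent_cone P v"
  then obtain k y where u: "u = k *\<^sub>R (y - v)" "0 \<le> k" "y \<in> P"
    by (auto simp: tangent_cone_def conic_hull_explicit)
  have "\<phi> i u = k * (\<phi> i y - \<phi> i v)" if "i \<in> I" for i
    unfolding u(1) using linear[OF that] by (simp add: linear_scale linear_diff)
  moreover have "u \<in> U"
    using u v_in_P subspace by (simp add: P_eq subspace_diff subspace_scale)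
  ultimately show "u \<in> {u \<in> U. \<forall>i\<in>I. \<phi> i v = r i \<longrightarrow> 0 \<le> \<phi> i u}"
    using u(2,3) by (simp add: P_eq)
next
  fix u assume "u \<in> {u \<in> U. \<forall>i\<in>I. \<phi> i v = r i \<longrightarrow> 0 \<le> \<phi> i u}"
  then have u: "u \<in> U" "\<And>i. i \<in> I \<Longrightarrow> \<phi> i v = r i \<Longrightarrow> 0 \<le> \<phi> i u" by auto
  have v': "v \<in> U" "\<And>i. i \<in> I \<Longrightarrow> r i \<le> \<phi> i v"
    using v_in_P P_eq by auto
  have "\<exists>K>0. \<forall>i\<in>I. - \<phi> i u \<le> K * (\<phi> i v - r i)"
    by (rule finite_common_multiplier[OF finite]) (simp_all add: u(2) v'(2))
  then obtain K where K: "0 < K" "\<And>i. i \<in> I \<Longrightarrow> - \<phi> i u \<le> K * (\<phi> i v - r i)"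
    by blast
  let ?y = "v + (1 / K) *\<^sub>R u"
  have "r i \<le> \<phi> i ?y" if "i \<in> I" for i
    using K(1) K(2)[OF that] linear[OF that] by (simp add: linear_add linear_scale field_simps)
  then have "?y \<in> P"
    using subspace v'(1) u(1) by (simp add: P_eq subspace_add subspace_scale)
  then show "u \<in> tangent_cone P v"
    using scaleR_diff_in_tangent_cone[of ?y P K v] K(1) by simp
qed

lemma span_cone_with_interior_point:
  fixes \<phi> :: "'i \<Rightarrow> 'a::real_vector \<Rightarrow> real"
  assumes subspace: "subspace U" and finite: "finite I" and linear: "\<And>i. i \<in> I \<Longrightarrow> linear (\<phi> i)"
    and y: "y \<in> U" "\<And>i. i \<in> I \<Longrightarrow> 0 < \<phi> i y"
  shows "span {u \<in> U. \<forall>i\<in>I. 0 \<le> \<phi> i u} = U" (is "span ?C = U")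
proof (intro subset_antisym subsetI)
  show "u \<in> U" if "u \<in> span ?C" for u
    using that span_minimal[of ?C U] subspace by auto
  fix u assume u: "u \<in> U"
  have "\<exists>K>0. \<forall>i\<in>I. - \<phi> i u \<le> K * \<phi> i y"
    by (rule finite_common_multiplier[OF finite]) (use y(2) in \<open>force intro: less_imp_le\<close>)+
  then obtain K where K: "0 < K" "\<And>i. i \<in> I \<Longrightarrow> - \<phi> i u \<le> K * \<phi> i y"
    by blast
  have "0 \<le> \<phi> i (K *\<^sub>R y + u)" if "i \<in> I" for i
    using K(2)[OF that] linear[OF that] by (simp add: linear_add linear_scale)
  then have "K *\<^sub>R y + u \<in> ?C"
    using subspace u y(1) by (simp add: subspace_add subspace_scale)
  moreover have "y \<in> ?C"
    using y by (simp add: less_imp_le)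
  ultimately have "(K *\<^sub>R y + u) - K *\<^sub>R y \<in> span ?C"
    by (intro span_diff span_scale span_base)
  then show "u \<in> span ?C"
    by simp
qed

locale simplicial_polyhedral_cone =
  fixes B :: "'a::real_vector set" and I :: "'i set" and \<phi> :: "'i \<Rightarrow> 'a \<Rightarrow> real"
  assumes finite_rays: "finite B" and independent_rays: "independent B" and finite_index: "finite I"
    and linear: "\<And>i. i \<in> I \<Longrightarrow> linear (\<phi> i)"
    and cone_eq: "convex_cone hull B = {u \<in> span B. \<forall>i\<in>I. 0 \<le> \<phi> i u}"
begin

lemma nonneg_on_ray: "i \<in> I \<Longrightarrow> b \<in> B \<Longrightarrow> 0 \<le> \<phi> i b"
  using cone_eq hull_inc[of b B convex_cone] by blast

definition supports_opposite_facet :: "'i \<Rightarrow> 'a \<Rightarrow> bool" where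
  "supports_opposite_facet i b \<longleftrightarrow> i \<in> I \<and> 0 < \<phi> i b \<and> (\<forall>x\<in>B - {b}. \<phi> i x = 0)"

text \<open>Otherwise every functional positive at \<open>b\<close> is positive at the sum of the other rays, and a
  large multiple of that sum minus \<open>b\<close> lies in the cone.\<close>

lemma opposite_facet_exists:
  assumes b: "b \<in> B"
  shows "\<exists>i. supports_opposite_facet i b"
proof (rule ccontr)
  assume no_facet: "\<not> ?thesis"
  define p where "p = (\<Sum>x\<in>B - {b}. x)"
  have \<phi>_p: "\<phi> i p = (\<Sum>x\<in>B - {b}. \<phi> i x)" if "i \<in> I" for i
    unfolding p_def by (rule linear_sum[OF linear[OF that]])
  have "0 \<le> \<phi> i p" if "i \<in> I" for i
    using nonneg_on_ray that by (auto simp: \<phi>_p intro: sum_nonneg)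
  moreover have "\<phi> i b \<le> 0" if i: "i \<in> I" "\<phi> i p = 0" for i
  proof -
    have "\<forall>x\<in>B - {b}. \<phi> i x = 0"
      using i finite_rays nonneg_on_ray by (subst sum_nonneg_eq_0_iff[symmetric]) (auto simp: \<phi>_p)
    then show ?thesis
      using no_facet i(1) by (auto simp: supports_opposite_facet_def not_less)
  qed
  ultimately have "\<exists>K>0. \<forall>i\<in>I. \<phi> i b \<le> K * \<phi> i p"
    by (rule finite_common_multiplier[OF finite_index])
  then obtain K where K: "\<And>i. i \<in> I \<Longrightarrow> \<phi> i b \<le> K * \<phi> i p"
    by blast
  have p: "p \<in> span (B - {b})"
    unfolding p_def by (intro span_sum span_base)
  moreover have "span (B - {b}) \<subseteq> span B"
    by (rule span_mono) blast
  ultimately have "K *\<^sub>R p - b \<in> span B"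
    using span_diff[OF span_scale span_base[OF b]] by blast
  then have "K *\<^sub>R p - b \<in> convex_cone hull B"
    using K linear by (simp add: cone_eq linear_diff linear_scale)
  then show False
    using diff_notin_convex_cone_hull[OF finite_rays independent_rays b span_scale[OF p]]
    by blast
qed

text \<open>Proportional functionals support the same facet; the choice keeps one of them for each ray.\<close>

definition facet_functional :: "'a \<Rightarrow> 'i" where
  "facet_functional b = (SOME i. supports_opposite_facet i b)"

definition facets :: "'i set" where
  "facets = facet_functional ` B"

lemma facet_functional:
  assumes "b \<in> B"
  shows "supports_opposite_facet (facet_functional b) b"
  unfolding facet_functional_def using opposite_facet_exists[OF assms] by (rule someI_ex)

lemma facets_subset: "facets \<subseteq> I"
  using facet_functional by (auto simp: facets_def supports_opposite_facet_def)

lemma finite_facets: "finite facets"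
  by (simp add: facets_def finite_rays)

lemma facet_functional_combination:
  assumes b: "b \<in> B"
  shows "\<phi> (facet_functional b) (\<Sum>x\<in>B. k x *\<^sub>R x) = k b * \<phi> (facet_functional b) b"
proof -
  note facet = facet_functional[OF b, unfolded supports_opposite_facet_def]
  have "\<phi> (facet_functional b) (\<Sum>x\<in>B. k x *\<^sub>R x) = (\<Sum>x\<in>B. k x * \<phi> (facet_functional b) x)"
    using facet linear by (simp add: linear_sum linear_scale)
  also have "\<dots> = k b * \<phi> (facet_functional b) b"
    using facet finite_rays b by (simp add: sum.remove[of B b])
  finally show ?thesis .
qed

lemma zero_if_facets_zero:
  assumes "u \<in> span B" "\<And>i. i \<in> facets \<Longrightarrow> \<phi> i u = 0"
  shows "u = 0"
proof -
  obtain k where k: "u = (\<Sum>b\<in>B. k b *\<^sub>R b)"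
    using assms(1) unfolding span_finite[OF finite_rays] by blast
  have "k b = 0" if b: "b \<in> B" for b
    using assms(2)[of "facet_functional b"] facet_functional_combination[OF b, of k]
      facet_functional[OF b] b
    by (simp add: facets_def k supports_opposite_facet_def)
  then show ?thesis
    by (simp add: k)
qed

lemma irredundant_in_facets:
  assumes "i \<in> I" "z \<in> span B" "\<phi> i z < 0" "\<And>j. j \<in> I \<Longrightarrow> j \<noteq> i \<Longrightarrow> 0 \<le> \<phi> j z"
  shows "i \<in> facets"
proof -
  obtain k where k: "z = (\<Sum>b\<in>B. k b *\<^sub>R b)"
    using assms(2) unfolding span_finite[OF finite_rays] by blast
  have "\<phi> i z = (\<Sum>b\<in>B. k b * \<phi> i b)"
    using linear[OF assms(1)] by (simp add: k linear_sum linear_scale)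
  then have "\<not> (\<forall>b\<in>B. 0 \<le> k b * \<phi> i b)"
    using assms(3) sum_nonneg[of B "\<lambda>b. k b * \<phi> i b"] by auto
  then obtain b where b: "b \<in> B" "k b * \<phi> i b < 0"
    by (auto simp: not_le)
  then have "k b < 0"
    using nonneg_on_ray[OF assms(1)] by (simp add: mult_less_0_iff not_less[symmetric])
  have "\<phi> (facet_functional b) z = k b * \<phi> (facet_functional b) b"
    unfolding k by (rule facet_functional_combination[OF b(1)])
  also have "\<dots> < 0"
    using \<open>k b < 0\<close> facet_functional[OF b(1)]
    by (simp add: mult_neg_pos supports_opposite_facet_def)
  finally have "\<phi> (facet_functional b) z < 0" .
  moreover have "facet_functional b \<in> I"
    using facet_functional[OF b(1)] by (simp add: supports_opposite_facet_def)
  ultimately have "facet_functional b = i"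
    using assms(4) by (metis linorder_not_le)
  then show ?thesis
    using b(1) by (auto simp: facets_def)
qed

lemma facets_independent:
  assumes J: "J \<subseteq> facets" and zero: "\<And>u. u \<in> span B \<Longrightarrow> (\<Sum>i\<in>J. w i * \<phi> i u) = 0"
    and i: "i \<in> J"
  shows "w i = 0"
proof -
  obtain b where b: "b \<in> B" "i = facet_functional b"
    using J i by (auto simp: facets_def)
  have "\<phi> j b = 0" if "j \<in> J - {i}" for j
  proof -
    obtain c where "c \<in> B" "j = facet_functional c"
      using J \<open>j \<in> J - {i}\<close> by (auto simp: facets_def)
    then show ?thesis
      using facet_functional[of c] b that by (auto simp: supports_opposite_facet_def)
  qed
  then have "(\<Sum>j\<in>J. w j * \<phi> j b) = w i * \<phi> i b"
    using i finite_subset[OF J finite_facets] by (simp add: sum.remove[of J i])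
  then show ?thesis
    using zero[of b] b facet_functional[OF b(1)]
    by (simp add: span_base supports_opposite_facet_def)
qed

text \<open>The functionals that are nonnegative on the cone form a simplicial cone themselves; two of its
  extreme rays span a face.\<close>

lemma summand_of_facet_sum:
  assumes ij: "i \<in> facets" "j \<in> facets" and kl: "k \<in> I" "l \<in> I"
    and sum_eq: "\<And>u. u \<in> span B \<Longrightarrow> \<phi> i u + \<phi> j u = \<phi> k u + \<phi> l u"
  obtains \<alpha> \<beta> where "\<And>u. u \<in> span B \<Longrightarrow> \<phi> k u = \<alpha> * \<phi> i u + \<beta> * \<phi> j u"
proof -
  obtain b c where b: "b \<in> B" "supports_opposite_facet i b"
    and c: "c \<in> B" "supports_opposite_facet j c"
    using ij facet_functional by (auto simp: facets_def)
  define \<alpha> where "\<alpha> = \<phi> k b / \<phi> i b"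
  define \<beta> where "\<beta> = (if c = b then 0 else \<phi> k c / \<phi> j c)"
  have "\<phi> k x - (\<alpha> * \<phi> i x + \<beta> * \<phi> j x) = 0" if x: "x \<in> B" for x
  proof (cases "x = b \<or> x = c")
    case False
    then have "\<phi> i x = 0" "\<phi> j x = 0"
      using b c x by (auto simp: supports_opposite_facet_def)
    moreover from this have "\<phi> k x = 0"
      using sum_eq[OF span_base[OF x]] nonneg_on_ray[OF _ x] kl by (simp add: add_nonneg_eq_0_iff)
    ultimately show ?thesis by simp
  qed (use b c in \<open>auto simp: \<alpha>_def \<beta>_def supports_opposite_facet_def\<close>)
  moreover have "linear (\<lambda>u. \<phi> k u - (\<alpha> * \<phi> i u + \<beta> * \<phi> j u))"
    using linear facets_subset ij kl(1)
    by (intro linear_compose_sub linear_compose_add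
        linear_compose_scale_right[where 'b = real, simplified]) blast+
  ultimately have "\<phi> k u - (\<alpha> * \<phi> i u + \<beta> * \<phi> j u) = 0" if "u \<in> span B" for u
    using linear_eq_0_on_span that by blast
  then show thesis
    using that by simp
qed

end

section \<open>Dyck paths\<close>

lemma segments_iff: "s \<in> segments n \<longleftrightarrow> 1 \<le> fst s \<and> fst s < snd s \<and> snd s \<le> n"
  by (cases s) (simp add: segments_def)

text \<open>The cell \<open>(i, j)\<close> is pictured in row \<open>i\<close> and column \<open>j\<close>, so a step goes down or to the
  right. Paths stay in the rows from 1 on, where the subtraction in \<open>cell_above\<close> is not truncated.\<close>

definition cell_above :: "nat \<times> nat \<Rightarrow> nat \<times> nat" where
  "cell_above s = (fst s - 1, snd s)"

definition cell_right :: "nat \<times> nat \<Rightarrow> nat \<times> nat" where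
  "cell_right s = (fst s, snd s + 1)"

definition dyck_step :: "nat \<times> nat \<Rightarrow> nat \<times> nat \<Rightarrow> bool" where
  "dyck_step s t \<longleftrightarrow> t = (fst s + 1, snd s) \<or> t = cell_right s"

definition level :: "nat \<times> nat \<Rightarrow> nat" where
  "level s = fst s + snd s"

lemma dyck_path_iff:
  "dyck_path n d \<longleftrightarrow>
     d \<noteq> [] \<and> set d \<subseteq> segments n \<and>
     snd (hd d) = fst (hd d) + 1 \<and> snd (last d) = fst (last d) + 1 \<and> successively dyck_step d"
  by (auto simp: dyck_path_def successively_conv_nth dyck_step_def cell_right_def)

lemma dyck_path_segment: "dyck_path n d \<Longrightarrow> s \<in> set d \<Longrightarrow> s \<in> segments n"
  by (auto simp: dyck_path_iff)

lemma map_level_dyck_steps: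
  assumes "successively dyck_step d" "d \<noteq> []"
  shows "map level d = [level (hd d)..<Suc (level (last d))]"
  using assms
proof (induction d rule: induct_list012)
  case (3 s t d)
  then have "level t = Suc (level s)"
    by (auto simp: dyck_step_def level_def cell_right_def)
  moreover have "map level (t # d) = [level t..<Suc (level (last (t # d)))]"
    using 3 by (simp add: successively_Cons)
  moreover from this have "level t < Suc (level (last (t # d)))"
    by (metis list.simps(3) list.simps(9) not_less upt_conv_Nil)
  ultimately show ?case
    by (simp add: upt_conv_Cons del: upt_Suc)
qed simp_all

lemma inj_on_level_dyck_path: "dyck_path n d \<Longrightarrow> inj_on level (set d)"
  using map_level_dyck_steps[of d] by (metis distinct_map distinct_upt dyck_path_iff)

lemma dyck_path_distinct: "dyck_path n d \<Longrightarrow> distinct d"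
  using map_level_dyck_steps[of d] by (metis distinct_map distinct_upt dyck_path_iff)

lemma dyck_path_eqI:
  assumes "dyck_path n d" "dyck_path n d'" "set d \<subseteq> set d'"
    and "level (hd d) = level (hd d')" "level (last d) = level (last d')"
  shows "d = d'"
proof (rule map_inj_on)
  show "map level d = map level d'"
    using assms map_level_dyck_steps[of d] map_level_dyck_steps[of d'] by (simp add: dyck_path_iff)
  show "inj_on level (set d \<union> set d')"
    using inj_on_level_dyck_path[OF assms(2)] assms(3) by (simp add: Un_absorb1)
qed

lemma finite_dyck_paths [simp]: "finite {d. dyck_path n d}"
  by (rule finite_subset[OF _ finite_subset_distinct[OF finite_segments[of n]]])
    (auto simp: dyck_path_iff dyck_path_distinct)

lemma sorted_wrt_less_chain:
  fixes xs :: "'a::order list"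
  shows "sorted_wrt (<) xs \<Longrightarrow> Complete_Partial_Order.chain (\<le>) (set xs)"
  by (induction xs) (auto simp: chain_def less_imp_le)

lemma hd_le_if_sorted_wrt_less:
  fixes xs :: "'a::order list"
  shows "sorted_wrt (<) xs \<Longrightarrow> x \<in> set xs \<Longrightarrow> hd xs \<le> x"
  by (cases xs) (auto simp: less_imp_le)

lemma le_last_if_sorted_wrt_less:
  fixes xs :: "'a::order list"
  shows "sorted_wrt (<) xs \<Longrightarrow> x \<in> set xs \<Longrightarrow> x \<le> last xs"
  by (cases xs rule: rev_cases) (auto simp: sorted_wrt_append less_imp_le)

lemma dyck_path_sorted:
  assumes "dyck_path n d"
  shows "sorted_wrt (<) d"
proof -
  have "s < t" if "dyck_step s t" for s t
    using that by (auto simp: dyck_step_def cell_right_def less_prod_def less_eq_prod_def)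
  moreover have "successively dyck_step d"
    using assms by (simp add: dyck_path_iff)
  ultimately have "successively (<) d"
    using successively_mono by blast
  then show ?thesis
    by (subst (asm) successively_conv_sorted_wrt) (auto intro: transpI)
qed

lemmas dyck_path_chain = sorted_wrt_less_chain[OF dyck_path_sorted]
  and hd_le_dyck_path = hd_le_if_sorted_wrt_less[OF dyck_path_sorted]
  and dyck_path_le_last = le_last_if_sorted_wrt_less[OF dyck_path_sorted]

lemma dyck_path_span_segment:
  assumes "dyck_path n d"
  shows "(fst (hd d), snd (last d)) \<in> segments n"
proof -
  have "hd d \<in> segments n" "last d \<in> segments n"
    using assms by (auto simp: dyck_path_iff)
  moreover have "hd d \<le> last d"
    using hd_le_dyck_path[OF assms] assms by (simp add: dyck_path_iff)
  ultimately show ?thesis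
    by (auto simp: segments_iff less_eq_prod_def)
qed

abbreviation weight_sum :: "(nat \<Rightarrow> nat) \<Rightarrow> nat \<Rightarrow> nat \<Rightarrow> real" where
  "weight_sum a i j \<equiv> (\<Sum>k = i..<j. real (a k))"

lemma path_bound_eq:
  assumes "dyck_path n d"
  shows "path_bound a d = weight_sum a (fst (hd d)) (snd (last d))"
  using assms by (simp add: path_bound_def dyck_path_iff atLeastLessThanSuc_atLeastAtMost)

lemma cell_above_in_dyck_path_iff:
  assumes "dyck_path n (p @ s # q)"
  shows "cell_above s \<in> set (p @ s # q) \<longleftrightarrow> p \<noteq> [] \<and> last p = cell_above s"
proof
  assume above: "cell_above s \<in> set (p @ s # q)"
  have sorted: "sorted_wrt (<) (p @ s # q)"
    by (rule dyck_path_sorted[OF assms])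
  have "1 \<le> fst s"
    using assms by (simp add: dyck_path_iff segments_iff)
  then have "cell_above s < s"
    by (auto simp: cell_above_def less_prod_def less_eq_prod_def)
  then have p: "cell_above s \<in> set p"
    using above sorted by (auto simp: sorted_wrt_append dest: less_asym)
  then have "cell_above s \<le> last p"
    using sorted by (intro le_last_if_sorted_wrt_less) (simp_all add: sorted_wrt_append)
  then have "snd s \<le> snd (last p)"
    by (simp add: cell_above_def less_eq_prod_def)
  moreover have "dyck_step (last p) s"
    using assms p by (auto simp: dyck_path_iff successively_append_iff)
  ultimately show "p \<noteq> [] \<and> last p = cell_above s"
    using p by (auto simp: dyck_step_def cell_right_def cell_above_def)
qed (metis Un_iff last_in_set set_append)

lemma cell_right_in_dyck_path_iff:
  assumes "dyck_path n (p @ s # q)"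
  shows "cell_right s \<in> set (p @ s # q) \<longleftrightarrow> q \<noteq> [] \<and> hd q = cell_right s"
proof
  assume right: "cell_right s \<in> set (p @ s # q)"
  have sorted: "sorted_wrt (<) (p @ s # q)"
    by (rule dyck_path_sorted[OF assms])
  have "s < cell_right s"
    by (auto simp: cell_right_def less_prod_def less_eq_prod_def)
  then have q: "cell_right s \<in> set q"
    using right sorted by (auto simp: sorted_wrt_append dest: less_asym)
  then have "hd q \<le> cell_right s"
    using sorted by (intro hd_le_if_sorted_wrt_less) (simp_all add: sorted_wrt_append)
  then have "fst (hd q) \<le> fst s"
    by (simp add: cell_right_def less_eq_prod_def)
  moreover have "dyck_step s (hd q)"
    using assms q by (auto simp: dyck_path_iff successively_append_iff successively_Cons)
  ultimately show "q \<noteq> [] \<and> hd q = cell_right s"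
    using q by (auto simp: dyck_step_def cell_right_def)
qed (metis Un_iff hd_in_set list.set_intros(2) set_append)

lemma dyck_path_predecessor:
  assumes "dyck_path n d" "s \<in> set d" "s \<noteq> hd d"
  shows "cell_above s \<in> set d \<or> (\<exists>t\<in>set d. s = cell_right t)"
proof -
  obtain p q where d: "d = p @ s # q"
    using assms(2) by (auto simp: in_set_conv_decomp)
  then have "p \<noteq> []"
    using assms(3) by auto
  then have "dyck_step (last p) s" "last p \<in> set d"
    using assms(1) d by (auto simp: dyck_path_iff successively_append_iff)
  then show ?thesis
    by (auto simp: dyck_step_def cell_above_def)
qed

lemma dyck_path_successor:
  assumes "dyck_path n d" "s \<in> set d" "s \<noteq> last d"
  shows "cell_right s \<in> set d \<or> (fst s + 1, snd s) \<in> set d"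
proof -
  obtain p q where d: "d = p @ s # q"
    using assms(2) by (auto simp: in_set_conv_decomp)
  then have "q \<noteq> []"
    using assms(3) by auto
  then have "dyck_step s (hd q)" "hd q \<in> set d"
    using assms(1) d by (auto simp: dyck_path_iff successively_append_iff successively_Cons)
  then show ?thesis
    by (auto simp: dyck_step_def)
qed

lemma dyck_path_swap:
  assumes "dyck_path n (p @ s # q)" "dyck_path n (p' @ s # q')"
  shows "dyck_path n (p @ s # q')"
  using assms by (auto simp: dyck_path_iff successively_append_iff successively_Cons hd_append)

lemma path_bound_swap:
  assumes "dyck_path n (p @ s # q)" "dyck_path n (p' @ s # q')"
  shows "path_bound a (p @ s # q') + path_bound a (p' @ s # q)
       = path_bound a (p @ s # q) + path_bound a (p' @ s # q')"
proof -
  define W where "W k = (\<Sum>i<k. real (a i))" for k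
  have W: "path_bound a d = W (snd (last d)) - W (fst (hd d))" if "dyck_path n d" for d
  proof -
    have "fst (hd d) \<le> snd (last d)"
      using dyck_path_span_segment[OF that] by (simp add: segments_iff)
    then show ?thesis
      using sum_diff_nat_ivl[of 0 "fst (hd d)" "snd (last d)" "\<lambda>k. real (a k)"]
      by (simp add: path_bound_eq[OF that] W_def lessThan_atLeast0)
  qed
  note dyck = assms dyck_path_swap[OF assms] dyck_path_swap[OF assms(2,1)]
  show ?thesis
    unfolding dyck[THEN W] by (simp add: hd_append split: if_splits)
qed

lemma dyck_path_bridge:
  assumes "dyck_path n p" "dyck_path n q" "fst (hd q) = snd (last p)"
  shows "dyck_path n (p @ cell_right (last p) # q)"
proof -
  have "last p \<in> segments n" "hd q \<in> segments n"
    using assms by (auto simp: dyck_path_iff)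
  then show ?thesis
    using assms by (auto simp: dyck_path_iff successively_append_iff successively_Cons dyck_step_def
        segments_iff cell_right_def prod_eq_iff)
qed

lemma path_bound_bridge:
  assumes p: "dyck_path n p" and q: "dyck_path n q" and link: "fst (hd q) = snd (last p)"
  shows "path_bound a (p @ cell_right (last p) # q) = path_bound a p + path_bound a q"
proof -
  have "p \<noteq> []" "q \<noteq> []" "fst (hd p) \<le> snd (last p)" "fst (hd q) \<le> snd (last q)"
    using p q dyck_path_span_segment[OF p] dyck_path_span_segment[OF q]
    by (auto simp: dyck_path_iff segments_iff)
  then show ?thesis
    unfolding path_bound_eq[OF p] path_bound_eq[OF q] path_bound_eq[OF dyck_path_bridge[OF p q link]]
    by (simp add: link sum.atLeastLessThan_concat)
qed

subsection \<open>Hooks\<close>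

lemma set_hook:
  "i < j \<Longrightarrow> set (hook i j) =
    {s. fst s = i \<and> i < snd s \<and> snd s \<le> j \<or> snd s = j \<and> i \<le> fst s \<and> fst s < j}"
  by (auto simp: hook_def image_iff simp del: upt_Suc)

lemma hd_hook: "i < j \<Longrightarrow> hd (hook i j) = (i, i + 1)"
  by (simp add: hook_def upt_conv_Cons del: upt_Suc)

lemma last_hook: "i < j \<Longrightarrow> last (hook i j) = (j - 1, j)"
  by (cases "i + 1 = j") (simp_all add: hook_def last_map)

lemma hook_inject: "i < j \<Longrightarrow> k < l \<Longrightarrow> hook i j = hook k l \<Longrightarrow> i = k \<and> j = l"
  by (metis hd_hook last_hook prod.inject)

lemma dyck_path_hook:
  assumes "(i, j) \<in> segments n"
  shows "dyck_path n (hook i j)"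
proof -
  have ij: "1 \<le> i" "i < j" "j \<le> n"
    using assms by (auto simp: segments_iff)
  have "successively dyck_step (map (\<lambda>k. (i, k)) [i + 1..<j + 1])"
    "successively dyck_step (map (\<lambda>k. (k, j)) [i + 1..<j])"
    by (auto simp: successively_conv_nth dyck_step_def cell_right_def simp del: upt_Suc)
  moreover have "dyck_step (i, j) (i + 1, j)"
    by (simp add: dyck_step_def)
  ultimately have "successively dyck_step (hook i j)"
    using ij(2) unfolding hook_def successively_append_iff
    by (cases "i + 1 = j") (simp_all add: last_map hd_map del: upt_Suc)
  moreover have "hook i j \<noteq> []" "set (hook i j) \<subseteq> segments n"
    using ij by (auto simp: hook_def segments_iff)
  ultimately show ?thesis
    using ij by (simp add: dyck_path_iff hd_hook last_hook)
qed

lemma path_bound_hook: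
  "(i, j) \<in> segments n \<Longrightarrow> path_bound a (hook i j) = weight_sum a i j"
  using path_bound_eq[OF dyck_path_hook] by (auto simp: hd_hook last_hook segments_iff)

lemma chain_subset_hook:
  assumes chain: "Complete_Partial_Order.chain (\<le>) C" and top: "(i, j) \<in> C"
    and C: "\<And>s. s \<in> C \<Longrightarrow> i \<le> fst s \<and> fst s < snd s \<and> snd s \<le> j"
  shows "C \<subseteq> set (hook i j)"
proof
  fix s assume s: "s \<in> C"
  then have "s \<le> (i, j) \<or> (i, j) \<le> s"
    using chain top by (auto simp: chain_def)
  then show "s \<in> set (hook i j)"
    using C[OF s] C[OF top] by (auto simp: set_hook less_eq_prod_def)
qed

lemma dyck_path_eq_hook:
  assumes d: "dyck_path n d" and top: "(fst (hd d), snd (last d)) \<in> set d"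
  shows "d = hook (fst (hd d)) (snd (last d))"
proof (rule dyck_path_eqI[OF d dyck_path_hook[OF dyck_path_span_segment[OF d]]])
  have "fst (hd d) < snd (last d)"
    using dyck_path_span_segment[OF d] by (simp add: segments_iff)
  then show "level (hd d) = level (hd (hook (fst (hd d)) (snd (last d))))"
    "level (last d) = level (last (hook (fst (hd d)) (snd (last d))))"
    using d by (simp_all add: hd_hook last_hook level_def dyck_path_iff)
  show "set d \<subseteq> set (hook (fst (hd d)) (snd (last d)))"
    using hd_le_dyck_path[OF d] dyck_path_le_last[OF d] dyck_path_segment[OF d]
    by (intro chain_subset_hook[OF dyck_path_chain[OF d] top])
      (auto simp: less_eq_prod_def segments_iff)
qed

section \<open>Corners and noncrossing families\<close>

definition outer_corner :: "(nat \<times> nat) list \<Rightarrow> nat \<times> nat \<Rightarrow> bool" where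
  "outer_corner d s \<longleftrightarrow> s \<in> set d \<and> cell_above s \<notin> set d \<and> cell_right s \<notin> set d"

definition inner_corner :: "(nat \<times> nat) list \<Rightarrow> nat \<times> nat \<Rightarrow> bool" where
  "inner_corner d s \<longleftrightarrow> s \<in> set d \<and> cell_above s \<in> set d \<and> cell_right s \<in> set d"

definition noncrossing :: "(nat \<times> nat) list set \<Rightarrow> bool" where
  "noncrossing F \<longleftrightarrow> (\<forall>d\<in>F. \<forall>d'\<in>F. \<forall>s\<in>set d \<inter> set d'.
     (cell_above s \<in> set d \<longleftrightarrow> cell_above s \<in> set d') \<or>
     (cell_right s \<in> set d \<longleftrightarrow> cell_right s \<in> set d'))"

lemma outer_corner_hook_iff: "i < j \<Longrightarrow> 1 \<le> i \<Longrightarrow> outer_corner (hook i j) s \<longleftrightarrow> s = (i, j)"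
  by (cases s) (auto simp: outer_corner_def set_hook cell_above_def cell_right_def)

lemma dyck_path_row_entered_from_above:
  assumes d: "dyck_path n d" and "(r, j) \<in> set d" "r \<noteq> fst (hd d)"
  obtains c where "c \<le> j" "(r, c) \<in> set d" "cell_above (r, c) \<in> set d"
proof -
  define c where "c = (LEAST c. (r, c) \<in> set d)"
  have c: "(r, c) \<in> set d"
    unfolding c_def using assms(2) by (rule LeastI)
  have c_least: "c \<le> c'" if "(r, c') \<in> set d" for c'
    unfolding c_def using that by (rule Least_le)
  have "(r, c) \<noteq> cell_right t" if "t \<in> set d" for t
    using c_least[of "snd t"] that by (auto simp: cell_right_def)
  then have "cell_above (r, c) \<in> set d"
    using dyck_path_predecessor[OF d c] assms(3) by (metis fst_conv)
  then show thesis
    using that c c_least[OF assms(2)] by blast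
qed

lemma dyck_path_without_inner_corner:
  assumes d: "dyck_path n d" and no_inner: "\<And>s. \<not> inner_corner d s"
  shows "d = hook (fst (hd d)) (snd (last d))"
proof (rule dyck_path_eq_hook[OF d])
  define j where "j = snd (last d)"
  define r where "r = (LEAST r. (r, j) \<in> set d)"
  have "last d = (fst (last d), j)" "last d \<in> set d"
    using d by (simp_all add: j_def dyck_path_iff prod_eq_iff)
  then have r: "(r, j) \<in> set d"
    unfolding r_def by (metis (mono_tags, lifting) LeastI)
  have r_least: "r \<le> r'" if "(r', j) \<in> set d" for r'
    unfolding r_def using that by (rule Least_le)
  have "r = fst (hd d)"
  proof (rule ccontr)
    assume "r \<noteq> fst (hd d)"
    then obtain c where c: "c \<le> j" "(r, c) \<in> set d" "cell_above (r, c) \<in> set d"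
      using dyck_path_row_entered_from_above[OF d r] by blast
    have "c \<noteq> j"
      using c(3) r_least[of "r - 1"] dyck_path_segment[OF d r]
      by (auto simp: cell_above_def segments_iff)
    then have "\<not> (r + 1, c) \<le> (r, j)" "\<not> (r, j) \<le> (r + 1, c)"
      using c(1) by auto
    then have "(r + 1, c) \<notin> set d"
      using dyck_path_chain[OF d] r unfolding chain_def by blast
    moreover have "(r, c) \<noteq> last d"
      using \<open>c \<noteq> j\<close> by (metis j_def snd_conv)
    ultimately have "cell_right (r, c) \<in> set d"
      using dyck_path_successor[OF d c(2)] by simp
    then show False
      using no_inner c(2,3) by (auto simp: inner_corner_def)
  qed
  then show "(fst (hd d), snd (last d)) \<in> set d"
    using r by (simp add: j_def)
qed

lemma outer_corner_neighbours:
  assumes d: "dyck_path n (p @ s # q)" and corner: "outer_corner (p @ s # q) s"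
  shows "p \<noteq> [] \<Longrightarrow> s = cell_right (last p)" and "q \<noteq> [] \<Longrightarrow> hd q = (fst s + 1, snd s)"
    and "p = [] \<longleftrightarrow> q = []"
proof -
  show p: "s = cell_right (last p)" if "p \<noteq> []"
    using that d corner cell_above_in_dyck_path_iff[OF d]
    by (auto simp: dyck_path_iff successively_append_iff dyck_step_def outer_corner_def
        cell_above_def)
  show q: "hd q = (fst s + 1, snd s)" if "q \<noteq> []"
    using that d corner cell_right_in_dyck_path_iff[OF d]
    by (auto simp: dyck_path_iff successively_append_iff successively_Cons dyck_step_def
        outer_corner_def)
  have "last p \<in> segments n" if "p \<noteq> []"
    using that by (intro dyck_path_segment[OF d]) simp
  moreover have "hd q \<in> segments n" if "q \<noteq> []"
    using that by (intro dyck_path_segment[OF d]) simp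
  ultimately show "p = [] \<longleftrightarrow> q = []"
    using p q d
    by (cases "p = []"; cases "q = []") (auto simp: dyck_path_iff segments_iff cell_right_def)
qed

lemma outer_corner_bend_or_bridge:
  assumes d: "dyck_path n (p @ s # q)" and corner: "outer_corner (p @ s # q) s" and "p \<noteq> []"
  shows "(\<exists>t. t \<noteq> s \<and> dyck_path n (p @ t # q)) \<or>
    dyck_path n p \<and> dyck_path n q \<and> fst (hd q) = snd (last p)"
proof -
  note neighbours = outer_corner_neighbours[OF d corner]
  have "q \<noteq> []" and s: "s = cell_right (last p)" and hd_q: "hd q = (fst s + 1, snd s)"
    using neighbours \<open>p \<noteq> []\<close> by simp_all
  let ?t = "(fst (last p) + 1, snd (last p))"
  show ?thesis
  proof (cases "?t \<in> segments n")
    case True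
    then have "dyck_path n (p @ ?t # q)" "?t \<noteq> s"
      using d s hd_q \<open>p \<noteq> []\<close> \<open>q \<noteq> []\<close>
      by (auto simp: dyck_path_iff successively_append_iff successively_Cons
          dyck_step_def cell_right_def prod_eq_iff)
    then show ?thesis by blast
  next
    case False
    moreover have "last p \<in> segments n"
      using \<open>p \<noteq> []\<close> by (intro dyck_path_segment[OF d]) simp
    ultimately have "snd (last p) = fst (last p) + 1"
      by (auto simp: segments_iff)
    then show ?thesis
      using d s hd_q \<open>p \<noteq> []\<close> \<open>q \<noteq> []\<close>
      by (auto simp: dyck_path_iff successively_append_iff successively_Cons cell_right_def)
  qed
qed

lemma dyck_path_enters_from_one_side:
  assumes d: "dyck_path n d" and s: "(Suc i, Suc j) \<in> set d" and "Suc i < j"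
  shows "(i, Suc j) \<in> set d \<longleftrightarrow> (Suc i, j) \<notin> set d"
proof -
  have "(Suc i, Suc j) \<noteq> hd d"
    using d assms(3) by (metis Suc_eq_plus1 dyck_path_iff fst_conv less_irrefl nat.inject snd_conv)
  then have "(i, Suc j) \<in> set d \<or> (Suc i, j) \<in> set d"
    using dyck_path_predecessor[OF d s] by (auto simp: cell_above_def cell_right_def)
  moreover have "\<not> ((i, Suc j) \<in> set d \<and> (Suc i, j) \<in> set d)"
    using dyck_path_chain[OF d] by (fastforce simp: chain_def)
  ultimately show ?thesis by blast
qed

lemma dyck_path_leaves_to_one_side:
  assumes d: "dyck_path n d" and s: "(i, j) \<in> set d" and "Suc i < j"
  shows "(Suc i, j) \<in> set d \<longleftrightarrow> (i, Suc j) \<notin> set d"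
proof -
  have "(i, j) \<noteq> last d"
    using d assms(3) by (metis Suc_eq_plus1 dyck_path_iff fst_conv less_irrefl snd_conv)
  then have "(Suc i, j) \<in> set d \<or> (i, Suc j) \<in> set d"
    using dyck_path_successor[OF d s] by (auto simp: cell_right_def)
  moreover have "\<not> ((Suc i, j) \<in> set d \<and> (i, Suc j) \<in> set d)"
    using dyck_path_chain[OF d] by (fastforce simp: chain_def)
  ultimately show ?thesis by blast
qed

definition flow :: "('a list \<Rightarrow> real) \<Rightarrow> 'a list set \<Rightarrow> 'a set \<Rightarrow> real" where
  "flow w F A = (\<Sum>d | d \<in> F \<and> A \<subseteq> set d. w d)"

lemma flow_split:
  assumes "finite F" "\<And>d. d \<in> F \<Longrightarrow> A \<subseteq> set d \<Longrightarrow> s \<in> set d \<longleftrightarrow> t \<notin> set d"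
  shows "flow w F A = flow w F (insert s A) + flow w F (insert t A)"
proof -
  have "{d. d \<in> F \<and> A \<subseteq> set d} =
      {d. d \<in> F \<and> insert s A \<subseteq> set d} \<union> {d. d \<in> F \<and> insert t A \<subseteq> set d}"
    using assms(2) by auto
  moreover have "{d. d \<in> F \<and> insert s A \<subseteq> set d} \<inter> {d. d \<in> F \<and> insert t A \<subseteq> set d} = {}"
    using assms(2) by auto
  ultimately show ?thesis
    unfolding flow_def using assms(1) by (simp add: sum.union_disjoint)
qed

lemma flow_leaving_cell:
  assumes "finite F" "\<And>d. d \<in> F \<Longrightarrow> dyck_path n d" "Suc i < j"
  shows "flow w F {(i, j)} = flow w F {(Suc i, j), (i, j)} + flow w F {(i, Suc j), (i, j)}"
  using assms by (intro flow_split dyck_path_leaves_to_one_side) auto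

lemma flow_entering_cell:
  assumes "finite F" "\<And>d. d \<in> F \<Longrightarrow> dyck_path n d" "Suc i < j"
  shows "flow w F {(Suc i, Suc j)} =
    flow w F {(i, Suc j), (Suc i, Suc j)} + flow w F {(Suc i, j), (Suc i, Suc j)}"
  using assms by (intro flow_split dyck_path_enters_from_one_side) auto

lemma flow_insert:
  "(\<And>d. d \<in> F \<Longrightarrow> A \<subseteq> set d \<Longrightarrow> s \<in> set d) \<Longrightarrow> flow w F (insert s A) = flow w F A"
  unfolding flow_def by (rule sum.cong) auto

lemma noncrossing_flow_through_cell:
  assumes "noncrossing F" and zero: "\<And>d. d \<in> F \<Longrightarrow> outer_corner d s \<Longrightarrow> flow w F {s} = 0"
  shows "flow w F {s} = 0 \<or> flow w F {s} = flow w F {cell_above s, s}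
    \<or> flow w F {s} = flow w F {cell_right s, s}"
proof (cases "\<exists>d\<in>F. outer_corner d s")
  case False
  then have "(\<forall>d\<in>F. s \<in> set d \<longrightarrow> cell_above s \<in> set d) \<or> (\<forall>d\<in>F. s \<in> set d \<longrightarrow> cell_right s \<in> set d)"
    using assms(1) unfolding noncrossing_def outer_corner_def by blast
  then show ?thesis
    using flow_insert[of F "{s}" "cell_above s" w] flow_insert[of F "{s}" "cell_right s" w] by auto
qed (use zero in blast)

text \<open>The flow through a cell that is not an outer corner also passes through a neighbour farther
  from the diagonal. Descending towards the diagonal, the flow is seen to vanish along all steps
  and cells.\<close>

lemma noncrossing_flow_eq_0:
  assumes F: "finite F" "\<And>d. d \<in> F \<Longrightarrow> dyck_path n d" "noncrossing F"
    and zero: "\<And>d s. d \<in> F \<Longrightarrow> outer_corner d s \<Longrightarrow> flow w F {s} = 0"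
  shows "flow w F {s} = 0"
proof -
  have "flow w F {(i, j)} = 0 \<and> flow w F {(i, Suc j), (i, j)} = 0" for i j
  proof (induction "n - (j - i)" arbitrary: i j rule: less_induct)
    case less
    show ?case
    proof (cases "(i, j) \<in> segments n")
      case False
      then have "d \<in> F \<Longrightarrow> (i, j) \<notin> set d" for d
        using F(2) dyck_path_segment by blast
      then show ?thesis
        by (auto simp: flow_def intro!: sum.neutral)
    next
      case True
      then obtain k where i: "i = Suc k"
        by (cases i) (auto simp: segments_iff)
      have seg: "Suc k < j" "j \<le> n"
        using True by (auto simp: i segments_iff)
      note IH = less.hyps[of j k] less.hyps[of "Suc j" i] less.hyps[of "Suc j" k]
      note leave = flow_leaving_cell[OF F(1,2), where w = w]
        and enter = flow_entering_cell[OF F(1,2), where w = w]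
      have above: "flow w F {(k, j), (i, j)} = 0"
        using leave[of k j] IH seg by (simp add: i insert_commute)
      have right: "flow w F {(i, Suc j), (i, j)} = 0"
        using enter[of k j] leave[of k "Suc j"] IH seg by (simp add: i insert_commute)
      show ?thesis
        using noncrossing_flow_through_cell[OF F(3) zero, of "(i, j)"] above right
        by (auto simp: i cell_above_def cell_right_def)
    qed
  qed
  then show ?thesis
    by (cases s) simp
qed

lemma card_noncrossing_le_outer_corners:
  assumes F: "finite F" "\<And>d. d \<in> F \<Longrightarrow> dyck_path n d" "noncrossing F"
    and independent: "\<And>w d. (\<And>s. flow w F {s} = 0) \<Longrightarrow> d \<in> F \<Longrightarrow> w d = 0"
  shows "card F \<le> card {s. \<exists>d\<in>F. outer_corner d s}"
proof (rule card_le_if_trivial_kernel[OF F(1)])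
  show "finite {s. \<exists>d\<in>F. outer_corner d s}"
    by (rule finite_subset[of _ "\<Union>(set ` F)"]) (auto simp: outer_corner_def F(1))
  fix w :: "(nat \<times> nat) list \<Rightarrow> real" and d
  assume zero: "(\<Sum>d\<in>F. w d * of_bool (s \<in> set d)) = 0" if "s \<in> {s. \<exists>d\<in>F. outer_corner d s}" for s
  have flow: "flow w F {s} = (\<Sum>d\<in>F. w d * of_bool (s \<in> set d))" for s
    unfolding flow_def by (subst sum.inter_filter[OF F(1)]) (rule sum.cong, simp_all)
  have "flow w F {s} = 0" if "d \<in> F" "outer_corner d s" for d s
    unfolding flow using that by (intro zero) blast
  note noncrossing_flow_eq_0[OF F this]
  then show "d \<in> F \<Longrightarrow> w d = 0"
    by (rule independent)
qed

section \<open>The inequalities of the FFLV polytope\<close>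

abbreviation coord :: "point \<Rightarrow> nat \<times> nat \<Rightarrow> real" where
  "coord \<equiv> Poly_Mapping.lookup"

abbreviation unit_point :: "nat \<times> nat \<Rightarrow> point" where
  "unit_point s \<equiv> Poly_Mapping.single s 1"

lemma coord_space_iff: "x \<in> coord_space n \<longleftrightarrow> (\<forall>s. s \<notin> segments n \<longrightarrow> coord x s = 0)"
  by (auto simp: coord_space_def in_keys_iff)

lemma subspace_coord_space: "subspace (coord_space n)"
  by (auto simp: subspace_def coord_space_iff lookup_add)

lemma coord_unit_point: "coord (unit_point s) t = of_bool (s = t)"
  by (simp add: lookup_single when_def)

lemma unit_point_in_coord_space: "s \<in> segments n \<Longrightarrow> unit_point s \<in> coord_space n"
  by (auto simp: coord_space_iff coord_unit_point)

lemma path_sum_simps [simp]: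
  "path_sum x [] = 0"
  "path_sum x (s # d) = coord x s + path_sum x d"
  "path_sum x (d @ d') = path_sum x d + path_sum x d'"
  by (simp_all add: path_sum_def)

lemma linear_coord: "linear (\<lambda>x. coord x s)"
  by (rule linearI) (simp_all add: lookup_add)

lemma linear_path_sum: "linear (\<lambda>x. path_sum x d)"
proof (rule linearI)
  show "path_sum (x + y) d = path_sum x d + path_sum y d" for x y
    by (induction d) (simp_all add: lookup_add)
  show "path_sum (r *\<^sub>R x) d = r *\<^sub>R path_sum x d" for r x
    by (induction d) (simp_all add: algebra_simps)
qed

lemma path_sum_eq_sum_set: "dyck_path n d \<Longrightarrow> path_sum x d = (\<Sum>s\<in>set d. coord x s)"
  by (simp add: path_sum_def dyck_path_distinct sum_list_distinct_conv_sum_set)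

lemma path_sum_unit_point: "dyck_path n d \<Longrightarrow> path_sum (unit_point s) d = of_bool (s \<in> set d)"
  by (simp add: path_sum_eq_sum_set coord_unit_point)

text \<open>The inequality \<open>x\<^sub>s \<ge> 0\<close> is indexed by \<open>Inl s\<close> and \<open>S(x, d) \<le> M(\<lambda>, d)\<close> by \<open>Inr d\<close>; both are
  written as a lower bound on a linear functional.\<close>

definition constraints :: "nat \<Rightarrow> ((nat \<times> nat) + (nat \<times> nat) list) set" where
  "constraints n = Inl ` segments n \<union> Inr ` {d. dyck_path n d}"

fun constraint_fun :: "(nat \<times> nat) + (nat \<times> nat) list \<Rightarrow> point \<Rightarrow> real" where
  "constraint_fun (Inl s) x = coord x s"
| "constraint_fun (Inr d) x = - path_sum x d"

fun constraint_bound :: "(nat \<Rightarrow> nat) \<Rightarrow> (nat \<times> nat) + (nat \<times> nat) list \<Rightarrow> real" where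
  "constraint_bound a (Inl s) = 0"
| "constraint_bound a (Inr d) = - path_bound a d"

definition active_constraints ::
    "nat \<Rightarrow> (nat \<Rightarrow> nat) \<Rightarrow> point \<Rightarrow> ((nat \<times> nat) + (nat \<times> nat) list) set" where
  "active_constraints n a v = {i \<in> constraints n. constraint_fun i v = constraint_bound a i}"

lemma finite_constraints: "finite (constraints n)"
  by (simp add: constraints_def)

lemma active_constraints_iff [simp]:
  "Inl s \<in> active_constraints n a v \<longleftrightarrow> s \<in> segments n \<and> coord v s = 0"
  "Inr d \<in> active_constraints n a v \<longleftrightarrow> dyck_path n d \<and> path_sum v d = path_bound a d"
  by (auto simp: active_constraints_def constraints_def)

lemma linear_constraint_fun: "linear (constraint_fun i)"
proof (cases i)
  case (Inr d)
  then show ?thesis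
    using linear_compose_neg[OF linear_path_sum[of d]]
    by (simp add: constraint_fun.simps(2)[abs_def])
qed (use linear_coord in \<open>simp add: constraint_fun.simps(1)[abs_def]\<close>)

lemma FFLV_eq_constraints:
  "FFLV n a = {x \<in> coord_space n. \<forall>i\<in>constraints n. constraint_bound a i \<le> constraint_fun i x}"
  unfolding FFLV_def constraints_def ball_Un by simp

fun constraint_coeff :: "(nat \<times> nat) + (nat \<times> nat) list \<Rightarrow> nat \<times> nat \<Rightarrow> real" where
  "constraint_coeff (Inl s) t = of_bool (s = t)"
| "constraint_coeff (Inr d) t = - of_bool (t \<in> set d)"

lemma constraint_fun_unit_point:
  "i \<in> constraints n \<Longrightarrow> constraint_fun i (unit_point t) = constraint_coeff i t"
  by (auto simp: constraints_def coord_unit_point path_sum_unit_point)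

lemma tangent_cone_FFLV:
  assumes "v \<in> FFLV n a"
  shows "tangent_cone (FFLV n a) v =
    {u \<in> coord_space n. \<forall>i\<in>active_constraints n a v. 0 \<le> constraint_fun i u}"
  by (subst tangent_cone_polyhedron[OF subspace_coord_space finite_constraints linear_constraint_fun
        FFLV_eq_constraints assms])
    (auto simp: active_constraints_def)

locale regular_weight =
  fixes n :: nat and a :: "nat \<Rightarrow> nat"
  assumes weight_pos: "\<And>i. i \<in> {1..n - 1} \<Longrightarrow> 0 < a i"
begin

lemma weight_sum_pos:
  assumes "1 \<le> i" "i < j" "j \<le> n"
  shows "0 < weight_sum a i j"
  using assms weight_pos by (intro sum_pos) auto

lemma path_bound_ge_1:
  assumes "dyck_path n d"
  shows "1 \<le> path_bound a d"
proof -
  have "0 < path_bound a d"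
    using dyck_path_span_segment[OF assms]
    by (simp add: path_bound_eq[OF assms] segments_iff weight_sum_pos)
  then show ?thesis
    by (simp add: path_bound_def flip: of_nat_sum)
qed

lemma FFLV_interior_point_exists:
  obtains y where "y \<in> coord_space n"
    "\<And>i. i \<in> constraints n \<Longrightarrow> constraint_bound a i < constraint_fun i y"
proof -
  define \<epsilon> where "\<epsilon> = 1 / (real (card (segments n)) + 1)"
  have \<epsilon>: "0 < \<epsilon>" "real (card (segments n)) * \<epsilon> < 1"
    by (simp_all add: \<epsilon>_def)
  define y where "y = (\<Sum>s\<in>segments n. \<epsilon> *\<^sub>R unit_point s)"
  have y: "coord y s = (if s \<in> segments n then \<epsilon> else 0)" for s
    by (simp add: y_def lookup_sum_singles)
  have "path_sum y d < path_bound a d" if d: "dyck_path n d" for d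
  proof -
    have "path_sum y d = (\<Sum>s\<in>set d. \<epsilon>)"
      unfolding path_sum_eq_sum_set[OF d] using dyck_path_segment[OF d] by (simp add: y)
    also have "\<dots> \<le> (\<Sum>s\<in>segments n. \<epsilon>)"
      using d \<epsilon>(1) by (intro sum_mono2) (auto simp: dyck_path_iff)
    also have "\<dots> < path_bound a d"
      using \<epsilon>(2) path_bound_ge_1[OF d] by simp
    finally show ?thesis .
  qed
  then show thesis
    using \<epsilon>(1) y by (intro that[of y]) (auto simp: constraints_def coord_space_iff)
qed

end

section \<open>Simple vertices are given by laminar sets\<close>

definition laminar :: "(nat \<times> nat) set \<Rightarrow> bool" where
  "laminar E \<longleftrightarrow> (\<forall>s\<in>E. \<forall>t\<in>E. fst s < fst t \<longrightarrow> fst t \<le> snd s \<longrightarrow> snd t \<le> snd s)"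

locale FFLV_simplicial_point = regular_weight +
  fixes v :: point and B :: "point set"
  assumes v_in_FFLV: "v \<in> FFLV n a"
    and finite_basis: "finite B" and independent_basis: "independent B"
    and tangent_cone_eq: "tangent_cone (FFLV n a) v = convex_cone hull B"
begin

lemma v_in_coord_space: "v \<in> coord_space n"
  using v_in_FFLV by (simp add: FFLV_def)

lemma v_nonneg: "s \<in> segments n \<Longrightarrow> 0 \<le> coord v s"
  using v_in_FFLV by (simp add: FFLV_def)

lemma path_sum_v_le: "dyck_path n d \<Longrightarrow> path_sum v d \<le> path_bound a d"
  using v_in_FFLV by (simp add: FFLV_def)

lemma span_basis: "span B = coord_space n"
proof -
  obtain y where y: "y \<in> coord_space n"
    "\<And>i. i \<in> constraints n \<Longrightarrow> constraint_bound a i < constraint_fun i y"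
    using FFLV_interior_point_exists by blast
  have "0 < constraint_fun i (y - v)" if "i \<in> active_constraints n a v" for i
    using y(2)[of i] that linear_diff[OF linear_constraint_fun]
    by (simp add: active_constraints_def)
  then have "span (tangent_cone (FFLV n a) v) = coord_space n"
    unfolding tangent_cone_FFLV[OF v_in_FFLV]
    using y(1) v_in_coord_space finite_constraints
    by (intro span_cone_with_interior_point[of _ _ _ "y - v"] subspace_coord_space
        linear_constraint_fun)
      (auto simp: active_constraints_def intro: subspace_diff[OF subspace_coord_space])
  then show ?thesis
    by (simp add: tangent_cone_eq span_convex_cone_hull)
qed

sublocale simplicial_polyhedral_cone B "active_constraints n a v" constraint_fun
proof (rule simplicial_polyhedral_cone.intro)
  show "finite (active_constraints n a v)"
    using finite_constraints by (simp add: active_constraints_def)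
  show "convex_cone hull B = {u \<in> span B. \<forall>i\<in>active_constraints n a v. 0 \<le> constraint_fun i u}"
    using tangent_cone_FFLV[OF v_in_FFLV] by (simp add: span_basis tangent_cone_eq)
qed (rule finite_basis independent_basis linear_constraint_fun)+

definition facet_paths :: "(nat \<times> nat) list set" where
  "facet_paths = {d. Inr d \<in> facets}"

definition supp :: "(nat \<times> nat) set" where
  "supp = {s \<in> segments n. coord v s \<noteq> 0}"

lemma supp_subset: "supp \<subseteq> segments n"
  by (auto simp: supp_def)

lemma finite_supp: "finite supp"
  by (rule finite_subset[OF supp_subset finite_segments])

lemma facet_path_active: "d \<in> facet_paths \<Longrightarrow> Inr d \<in> active_constraints n a v"
  using facets_subset by (auto simp: facet_paths_def)

lemma facet_path_dyck_path: "d \<in> facet_paths \<Longrightarrow> dyck_path n d"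
  using facet_path_active by simp

lemma path_sum_facet_path: "d \<in> facet_paths \<Longrightarrow> path_sum v d = path_bound a d"
  using facet_path_active by simp

lemma finite_facet_paths: "finite facet_paths"
  by (rule finite_subset[OF _ finite_dyck_paths[of n]]) (auto simp: facet_path_dyck_path)

lemma zero_coord_in_facets:
  assumes "s \<in> segments n" "coord v s = 0"
  shows "Inl s \<in> facets"
proof (rule irredundant_in_facets)
  show "Inl s \<in> active_constraints n a v"
    using assms by simp
  show "- unit_point s \<in> span B"
    using assms(1) subspace_neg[OF subspace_coord_space]
    by (simp add: span_basis unit_point_in_coord_space)
  show "constraint_fun (Inl s) (- unit_point s) < 0"
    by (simp add: coord_unit_point)
  show "0 \<le> constraint_fun j (- unit_point s)" if "j \<in> active_constraints n a v" "j \<noteq> Inl s" for j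
    using that linear_neg[OF linear_path_sum]
    by (cases j) (auto simp: coord_unit_point path_sum_unit_point)
qed

lemma facet_sum_summand_coeffs:
  assumes ij: "i \<in> facets" "j \<in> facets"
    and kl: "k \<in> active_constraints n a v" "l \<in> active_constraints n a v"
    and sum_eq:
      "\<And>u. constraint_fun i u + constraint_fun j u = constraint_fun k u + constraint_fun l u"
  obtains \<alpha> \<beta> where "\<And>t. t \<in> segments n \<Longrightarrow>
    constraint_coeff k t = \<alpha> * constraint_coeff i t + \<beta> * constraint_coeff j t"
proof -
  have "active_constraints n a v \<subseteq> constraints n"
    by (auto simp: active_constraints_def)
  then have "i \<in> constraints n" "j \<in> constraints n" "k \<in> constraints n"
    using ij kl(1) facets_subset by blast+
  moreover obtain \<alpha> \<beta> where
    "\<And>u. u \<in> coord_space n \<Longrightarrow> constraint_fun k u = \<alpha> * constraint_fun i u + \<beta> * constraint_fun j u"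
    using summand_of_facet_sum[OF ij kl sum_eq] by (metis span_basis)
  ultimately show thesis
    using that[of \<alpha> \<beta>] unit_point_in_coord_space constraint_fun_unit_point by metis
qed

lemma noncrossing_facet_paths: "noncrossing facet_paths"
  unfolding noncrossing_def
proof (intro ballI)
  fix d d' s assume d: "d \<in> facet_paths" and d': "d' \<in> facet_paths" and s: "s \<in> set d \<inter> set d'"
  obtain p q p' q' where split: "d = p @ s # q" "d' = p' @ s # q'"
    using s by (metis Int_iff split_list)
  have dyck: "dyck_path n (p @ s # q)" "dyck_path n (p' @ s # q')"
    using facet_path_dyck_path d d' split by auto
  define e e' where "e = p @ s # q'" and "e' = p' @ s # q"
  have e: "dyck_path n e" "dyck_path n e'"
    using dyck_path_swap[OF dyck] dyck_path_swap[OF dyck(2,1)] by (simp_all add: e_def e'_def)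
  have "path_sum v e + path_sum v e' = path_bound a e + path_bound a e'"
    using path_bound_swap[OF dyck, of a] path_sum_facet_path[OF d] path_sum_facet_path[OF d']
    by (simp add: split e_def e'_def)
  then have active: "Inr e \<in> active_constraints n a v" "Inr e' \<in> active_constraints n a v"
    using e path_sum_v_le[OF e(1)] path_sum_v_le[OF e(2)] by simp_all
  obtain \<alpha> \<beta> where coeff: "\<And>t. t \<in> segments n \<Longrightarrow>
      constraint_coeff (Inr e) t = \<alpha> * constraint_coeff (Inr d) t + \<beta> * constraint_coeff (Inr d') t"
    using facet_sum_summand_coeffs[of "Inr d" "Inr d'" "Inr e" "Inr e'"] d d' active
    by (auto simp: facet_paths_def split e_def e'_def)
  have above: "cell_above s \<in> set e \<longleftrightarrow> cell_above s \<in> set d"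
    using dyck(1) e(1) by (simp only: cell_above_in_dyck_path_iff e_def split)
  have right: "cell_right s \<in> set e \<longleftrightarrow> cell_right s \<in> set d'"
    using dyck(2) e(1) by (simp only: cell_right_in_dyck_path_iff e_def split)
  show "(cell_above s \<in> set d \<longleftrightarrow> cell_above s \<in> set d') \<or>
      (cell_right s \<in> set d \<longleftrightarrow> cell_right s \<in> set d')"
  proof (rule ccontr)
    assume crossing: "\<not> ?thesis"
    then have seg: "s \<in> segments n" "cell_above s \<in> segments n" "cell_right s \<in> segments n"
      using dyck_path_segment[OF dyck(1)] dyck_path_segment[OF dyck(2)] s unfolding split by blast+
    show False
      using coeff[OF seg(1)] coeff[OF seg(2)] coeff[OF seg(3)] above right crossing s
      by (auto simp: e_def of_bool_def split: if_splits)
  qed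
qed

lemma facet_path_bend_in_supp:
  assumes d: "p @ s # q \<in> facet_paths" and "p \<noteq> []" "q \<noteq> []"
    and bend: "dyck_path n (p @ t # q)" "t \<noteq> s"
  shows "s \<in> supp"
proof (rule ccontr)
  have seg: "s \<in> segments n" "t \<in> segments n"
    using dyck_path_segment[OF facet_path_dyck_path[OF d]] dyck_path_segment[OF bend(1)] by simp_all
  assume "s \<notin> supp"
  then have v_s: "coord v s = 0"
    using seg(1) by (simp add: supp_def)
  have "path_bound a (p @ t # q) = path_bound a (p @ s # q)"
    using assms(2,3) by (simp add: path_bound_def)
  then have active: "Inl t \<in> active_constraints n a v" "Inr (p @ t # q) \<in> active_constraints n a v"
    using path_sum_v_le[OF bend(1)] path_sum_facet_path[OF d] v_s v_nonneg[OF seg(2)] seg(2) bend(1)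
    by simp_all
  obtain \<alpha> \<beta> where "\<And>r. r \<in> segments n \<Longrightarrow> constraint_coeff (Inr (p @ t # q)) r =
      \<alpha> * constraint_coeff (Inr (p @ s # q)) r + \<beta> * constraint_coeff (Inl s) r"
    using facet_sum_summand_coeffs[of "Inr (p @ s # q)" "Inl s" "Inr (p @ t # q)" "Inl t"]
      d active zero_coord_in_facets[OF seg(1) v_s] by (auto simp: facet_paths_def)
  from this[OF seg(2)] show False
    using bend(2) dyck_path_distinct[OF bend(1)] by simp
qed

lemma facet_path_bridge_in_supp:
  assumes d: "p @ s # q \<in> facet_paths" and p: "dyck_path n p" and q: "dyck_path n q"
    and s: "s = cell_right (last p)" and link: "fst (hd q) = snd (last p)"
  shows "s \<in> supp"
proof (rule ccontr)
  have seg: "s \<in> segments n" "hd p \<in> segments n" "hd q \<in> segments n"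
    using dyck_path_segment[OF facet_path_dyck_path[OF d], of s] p q by (auto simp: dyck_path_iff)
  assume "s \<notin> supp"
  then have v_s: "coord v s = 0"
    using seg(1) by (simp add: supp_def)
  have "path_sum v p + path_sum v q = path_bound a p + path_bound a q"
    using path_sum_facet_path[OF d] path_bound_bridge[OF p q link, of a] v_s by (simp add: s)
  then have active: "Inr p \<in> active_constraints n a v" "Inr q \<in> active_constraints n a v"
    using path_sum_v_le[OF p] path_sum_v_le[OF q] p q by simp_all
  obtain \<alpha> \<beta> where coeff: "\<And>t. t \<in> segments n \<Longrightarrow> constraint_coeff (Inr p) t =
      \<alpha> * constraint_coeff (Inr (p @ s # q)) t + \<beta> * constraint_coeff (Inl s) t"
    using facet_sum_summand_coeffs[of "Inr (p @ s # q)" "Inl s" "Inr p" "Inr q"]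
      d active zero_coord_in_facets[OF seg(1) v_s] by (auto simp: facet_paths_def)
  have "hd p \<in> set p" "hd q \<in> set q" "hd p \<noteq> s" "hd q \<noteq> s" "hd q \<notin> set p"
    using p q dyck_path_distinct[OF facet_path_dyck_path[OF d]] by (auto simp: dyck_path_iff)
  then show False
    using coeff[OF seg(2)] coeff[OF seg(3)] by simp
qed

lemma inner_corner_in_supp:
  assumes d: "d \<in> facet_paths" and corner: "inner_corner d s"
  shows "s \<in> supp"
proof -
  obtain p q where split: "d = p @ s # q"
    using corner by (metis inner_corner_def split_list)
  have dyck: "dyck_path n (p @ s # q)"
    using facet_path_dyck_path[OF d] by (simp add: split)
  have p: "p \<noteq> []" "last p = cell_above s" and q: "q \<noteq> []" "hd q = cell_right s"
    using corner cell_above_in_dyck_path_iff[OF dyck] cell_right_in_dyck_path_iff[OF dyck]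
    by (auto simp: inner_corner_def split)
  have "last p \<in> segments n" "hd q \<in> segments n" "s \<in> segments n"
    using p(1) q(1) by (auto intro!: dyck_path_segment[OF dyck])
  then have "dyck_path n (p @ cell_right (cell_above s) # q)" "cell_right (cell_above s) \<noteq> s"
    using dyck p q
    by (auto simp: dyck_path_iff successively_append_iff successively_Cons segments_iff
        dyck_step_def cell_above_def cell_right_def prod_eq_iff)
  then show ?thesis
    using facet_path_bend_in_supp d p(1) q(1) by (simp add: split)
qed

lemma single_cell_facet_path_in_supp:
  assumes "[s] \<in> facet_paths"
  shows "s \<in> supp"
  using path_sum_facet_path[OF assms] path_bound_ge_1[OF facet_path_dyck_path[OF assms]]
    facet_path_dyck_path[OF assms]
  by (simp add: supp_def dyck_path_iff)

lemma outer_corner_in_supp: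
  assumes d: "d \<in> facet_paths" and corner: "outer_corner d s"
  shows "s \<in> supp"
proof -
  obtain p q where split: "d = p @ s # q"
    using corner by (metis outer_corner_def split_list)
  have dyck: "dyck_path n (p @ s # q)" and corner': "outer_corner (p @ s # q) s"
    using facet_path_dyck_path[OF d] corner by (simp_all add: split)
  note neighbours = outer_corner_neighbours[OF dyck corner']
  consider "p = []" "q = []"
    | t where "p \<noteq> []" "q \<noteq> []" "t \<noteq> s" "dyck_path n (p @ t # q)"
    | "p \<noteq> []" "dyck_path n p" "dyck_path n q" "fst (hd q) = snd (last p)"
    using neighbours(3) outer_corner_bend_or_bridge[OF dyck corner'] by blast
  then show ?thesis
  proof cases
    case 1
    then show ?thesis
      using single_cell_facet_path_in_supp d by (simp add: split)
  next
    case 2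
    then show ?thesis
      using facet_path_bend_in_supp d by (simp add: split)
  next
    case 3
    then show ?thesis
      using facet_path_bridge_in_supp neighbours(1) d by (simp add: split)
  qed
qed

lemma card_supp_le_facet_paths: "card supp \<le> card facet_paths"
proof (rule card_le_if_trivial_kernel[OF finite_supp finite_facet_paths])
  fix x s
  assume zero: "(\<Sum>s\<in>supp. x s * of_bool (s \<in> set d)) = (0 :: real)" if "d \<in> facet_paths" for d
  assume s: "s \<in> supp"
  define u where "u = (\<Sum>s\<in>supp. x s *\<^sub>R unit_point s)"
  have coord_u: "coord u t = (if t \<in> supp then x t else 0)" for t
    by (simp add: u_def lookup_sum_singles finite_supp)
  have "u = 0"
  proof (rule zero_if_facets_zero)
    show "u \<in> span B"
      using supp_subset by (auto simp: span_basis coord_space_iff coord_u)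
    fix i assume i: "i \<in> facets"
    then have active: "i \<in> active_constraints n a v"
      using facets_subset by blast
    show "constraint_fun i u = 0"
    proof (cases i)
      case (Inl t)
      then show ?thesis
        using active by (simp add: coord_u supp_def)
    next
      case (Inr d)
      then have "dyck_path n d" "d \<in> facet_paths"
        using i active by (simp_all add: facet_paths_def)
      then show ?thesis
        using zero[of d] Inr
        by (simp add: u_def linear_sum[OF linear_path_sum] linear_scale[OF linear_path_sum]
            path_sum_unit_point)
    qed
  qed
  then show "x s = 0"
    using coord_u[of s] s by simp
qed

lemma facet_paths_independent:
  assumes zero: "\<And>s. flow w facet_paths {s} = 0" and d: "d \<in> facet_paths"
  shows "w d = 0"
proof -
  have "(\<Sum>d\<in>facet_paths. w d * path_sum u d) = 0" for u
  proof -
    have "(\<Sum>d\<in>facet_paths. w d * path_sum u d) =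
        (\<Sum>d\<in>facet_paths. \<Sum>s\<in>segments n. if s \<in> set d then w d * coord u s else 0)"
    proof (rule sum.cong[OF refl])
      fix d assume "d \<in> facet_paths"
      then have "dyck_path n d" "set d = {s \<in> segments n. s \<in> set d}"
        using facet_path_dyck_path dyck_path_segment by blast+
      then show "w d * path_sum u d = (\<Sum>s\<in>segments n. if s \<in> set d then w d * coord u s else 0)"
        by (metis (no_types) path_sum_eq_sum_set sum_distrib_left sum.inter_filter finite_segments)
    qed
    also have "\<dots> = (\<Sum>s\<in>segments n. coord u s * flow w facet_paths {s})"
      by (subst sum.swap)
        (simp add: flow_def sum.inter_filter[OF finite_facet_paths] sum_distrib_left if_distrib
          mult.commute cong: if_cong)
    finally show ?thesis
      by (simp add: zero)
  qed
  then have "(\<Sum>i\<in>Inr ` facet_paths. w (projr i) * constraint_fun i u) = 0" for u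
    by (simp add: sum.reindex sum_negf)
  from facets_independent[OF _ this, of "Inr d"] show ?thesis
    using d by (auto simp: facet_paths_def)
qed

lemma supp_eq_outer_corners: "supp = {s. \<exists>d\<in>facet_paths. outer_corner d s}"
proof (rule sym, rule card_seteq[OF finite_supp])
  show "{s. \<exists>d\<in>facet_paths. outer_corner d s} \<subseteq> supp"
    using outer_corner_in_supp by blast
  have "card facet_paths \<le> card {s. \<exists>d\<in>facet_paths. outer_corner d s}"
    by (rule card_noncrossing_le_outer_corners[OF finite_facet_paths facet_path_dyck_path
          noncrossing_facet_paths]) (assumption, rule facet_paths_independent)
  then show "card supp \<le> card {s. \<exists>d\<in>facet_paths. outer_corner d s}"
    using card_supp_le_facet_paths by simp
qed

lemma facet_path_no_inner_corner:
  assumes d: "d \<in> facet_paths"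
  shows "\<not> inner_corner d s"
proof
  assume inner: "inner_corner d s"
  then obtain d' where "d' \<in> facet_paths" "outer_corner d' s"
    using inner_corner_in_supp[OF d] supp_eq_outer_corners by blast
  then show False
    using noncrossing_facet_paths d inner
    unfolding noncrossing_def inner_corner_def outer_corner_def by blast
qed

lemma hook_in_facet_paths:
  assumes "(i, j) \<in> supp"
  shows "hook i j \<in> facet_paths"
proof -
  obtain d where d: "d \<in> facet_paths" "outer_corner d (i, j)"
    using assms supp_eq_outer_corners by blast
  then have hook: "d = hook (fst (hd d)) (snd (last d))"
    using dyck_path_without_inner_corner facet_path_dyck_path facet_path_no_inner_corner by blast
  moreover have "(fst (hd d), snd (last d)) = (i, j)"
    using outer_corner_hook_iff[of "fst (hd d)" "snd (last d)" "(i, j)"] d hook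
      dyck_path_span_segment[OF facet_path_dyck_path[OF d(1)]] by (simp add: segments_iff)
  ultimately show ?thesis
    using d(1) by simp
qed

lemma segments_of_supp_not_linked:
  assumes s: "(i, j) \<in> supp"
  shows "(j, l) \<notin> supp"
proof
  assume t: "(j, l) \<in> supp"
  have ij: "(i, j) \<in> segments n" and jl: "(j, l) \<in> segments n" and "i < j" "j < l"
    using s t by (auto simp: supp_def segments_iff)
  let ?p = "hook i j" and ?q = "hook j l"
  let ?s = "cell_right (last ?p)"
  have paths: "?p \<in> facet_paths" "?q \<in> facet_paths"
    using hook_in_facet_paths s t by blast+
  have link: "fst (hd ?q) = snd (last ?p)"
    using \<open>i < j\<close> \<open>j < l\<close> by (simp add: hd_hook last_hook)
  note dyck = dyck_path_hook[OF ij] dyck_path_hook[OF jl]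
  note bridge = dyck_path_bridge[OF dyck link] path_bound_bridge[OF dyck link, of a]
  have seg: "?s \<in> segments n"
    using dyck_path_segment[OF bridge(1)] by simp
  have active: "Inl ?s \<in> active_constraints n a v" "Inr (?p @ ?s # ?q) \<in> active_constraints n a v"
    using path_sum_v_le[OF bridge(1)] v_nonneg[OF seg] bridge seg paths[THEN path_sum_facet_path]
    by simp_all
  obtain \<alpha> \<beta> where "\<And>t. t \<in> segments n \<Longrightarrow>
      constraint_coeff (Inl ?s) t =
        \<alpha> * constraint_coeff (Inr ?p) t + \<beta> * constraint_coeff (Inr ?q) t"
    using facet_sum_summand_coeffs[of "Inr ?p" "Inr ?q" "Inl ?s" "Inr (?p @ ?s # ?q)"] paths active
    by (auto simp: facet_paths_def)
  from this[OF seg] show False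
    using dyck_path_distinct[OF bridge(1)] by simp
qed

lemma laminar_supp: "laminar supp"
  unfolding laminar_def
proof (intro ballI impI, rule ccontr)
  fix s t assume s: "s \<in> supp" and t: "t \<in> supp" and lt: "fst s < fst t" and le: "fst t \<le> snd s"
    and not_nested: "\<not> snd t \<le> snd s"
  obtain i j k l where st: "s = (i, j)" "t = (k, l)"
    by (metis surj_pair)
  have ord: "i < j" "k < l" "i < k" "k \<le> j" "j < l"
    using s t lt le not_nested by (auto simp: st supp_def segments_iff)
  have paths: "hook i j \<in> facet_paths" "hook k l \<in> facet_paths"
    using hook_in_facet_paths s t by (simp_all add: st)
  show False
  proof (cases "k = j")
    case True
    then show ?thesis
      using segments_of_supp_not_linked s t by (simp add: st)
  next
    case False
    then have "(k, j) \<in> set (hook i j)" "(k, j) \<in> set (hook k l)"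
      "cell_above (k, j) \<in> set (hook i j)" "cell_above (k, j) \<notin> set (hook k l)"
      "cell_right (k, j) \<notin> set (hook i j)" "cell_right (k, j) \<in> set (hook k l)"
      using ord by (auto simp: set_hook cell_above_def cell_right_def)
    then show ?thesis
      using noncrossing_facet_paths paths unfolding noncrossing_def by blast
  qed
qed

lemma is_segment_point_supp: "is_segment_point n a supp v"
  unfolding is_segment_point_def
proof (intro conjI ballI)
  fix s assume s: "s \<in> segments n"
  obtain i j where ij: "s = (i, j)"
    by fastforce
  have "path_sum v (hook i j) = weight_sum a i j" if "(i, j) \<in> supp"
    using path_sum_facet_path[OF hook_in_facet_paths[OF that]] path_bound_hook[of i j n a] s
    by (simp add: ij)
  then show "case s of (i, j) \<Rightarrow> ((i, j) \<notin> supp \<longrightarrow> coord v (i, j) = 0) \<and>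
      ((i, j) \<in> supp \<longrightarrow> path_sum v (hook i j) = weight_sum a i j)"
    using s by (simp add: ij supp_def)
qed (rule v_in_coord_space)

lemma v_eq_segment_point: "v = segment_point n a supp"
  using is_segment_point_supp segment_point_spec is_segment_point_ex1 by blast

end

lemma (in regular_weight) simple_vertex_imp_laminar_segment_point:
  assumes "simple_vertex L (FFLV n a) v"
  obtains E where "E \<subseteq> segments n" "laminar E" "v = segment_point n a E"
proof -
  have "v \<in> FFLV n a"
    using assms by (simp add: simple_vertex_iff)
  moreover obtain B where "finite B" "independent B" "tangent_cone (FFLV n a) v = convex_cone hull B"
    using assms by (auto simp: simple_vertex_def simplicial_cone_def)
  ultimately interpret FFLV_simplicial_point n a v B
    by unfold_locales
  show thesis
    using that supp_subset laminar_supp v_eq_segment_point .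
qed

section \<open>Laminar sets give simple vertices\<close>

definition subsegments :: "nat \<Rightarrow> nat \<Rightarrow> (nat \<times> nat) set" where
  "subsegments i j = {s. i \<le> fst s \<and> snd s \<le> j}"

lemma laminar_split:
  assumes C: "finite C" "C \<noteq> {}" "laminar C"
  obtains p q where "(p, q) \<in> C" "\<And>s. s \<in> C \<Longrightarrow> p \<le> fst s"
    "\<And>s. s \<in> C \<Longrightarrow> q < snd s \<Longrightarrow> q < fst s"
proof -
  define p where "p = Min (fst ` C)"
  have p_le: "p \<le> fst s" if "s \<in> C" for s
    using C(1) that by (simp add: p_def)
  define row where "row = {s \<in> C. fst s = p}"
  have "p \<in> fst ` C"
    unfolding p_def using C(1,2) by (intro Min_in) auto
  then have row: "finite row" "row \<noteq> {}"
    using C(1) by (auto simp: row_def)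
  define q where "q = Max (snd ` row)"
  have "q \<in> snd ` row"
    unfolding q_def using row by (intro Max_in) auto
  then have pq: "(p, q) \<in> C"
    by (auto simp: row_def)
  moreover have "q < fst s" if s: "s \<in> C" "q < snd s" for s
  proof -
    have "s \<notin> row"
      using s(2) row(1) by (auto simp: q_def not_less[symmetric] dest: Max_ge[OF finite_imageI])
    then have "p < fst s"
      using s(1) p_le[OF s(1)] by (simp add: row_def)
    then show ?thesis
      using C(3) pq s by (force simp: laminar_def)
  qed
  ultimately show thesis
    using that p_le by blast
qed

lemma (in regular_weight) weight_sum_remove_less:
  assumes "1 \<le> i" "i \<le> p" "p < q" "q \<le> j" "j \<le> n" "(p, q) \<noteq> (i, j)"
  shows "weight_sum a p q + weight_sum a (q + 1) j < weight_sum a i j"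
proof -
  define k where "k = (if q < j then q else i)"
  have k: "i \<le> k" "k < j" "k \<notin> {p..<q} \<union> {q + 1..<j}"
    using assms by (auto simp: k_def)
  have "weight_sum a p q + weight_sum a (q + 1) j
      = (\<Sum>k\<in>{p..<q} \<union> {q + 1..<j}. real (a k))"
    by (intro sum.union_disjoint[symmetric]) auto
  also have "\<dots> < weight_sum a i j"
    using assms k weight_pos[of k] by (intro sum_strict_mono2[of _ _ k]) auto
  finally show ?thesis .
qed

locale laminar_segments = regular_weight +
  fixes E :: "(nat \<times> nat) set"
  assumes E_segments: "E \<subseteq> segments n" and laminar_E: "laminar E"
begin

abbreviation x\<^sub>E :: "nat \<times> nat \<Rightarrow> real" where
  "x\<^sub>E \<equiv> coord (segment_point n a E)"

lemma segment_point_in_coord_space: "segment_point n a E \<in> coord_space n"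
  using segment_point_spec[of n a E] by (simp add: is_segment_point_def)

lemma coord_outside: "s \<notin> E \<Longrightarrow> x\<^sub>E s = 0"
  using segment_point_spec[of n a E] segment_point_in_coord_space
  by (cases s) (auto simp: is_segment_point_def coord_space_iff)

lemma sum_coord_Int: "finite S \<Longrightarrow> (\<Sum>s\<in>S. x\<^sub>E s) = (\<Sum>s\<in>S \<inter> E. x\<^sub>E s)"
  by (rule sum.mono_neutral_right) (auto simp: coord_outside)

lemma sum_coord_hook:
  assumes "(i, j) \<in> E"
  shows "(\<Sum>s\<in>set (hook i j). x\<^sub>E s) = weight_sum a i j"
proof -
  have ij: "(i, j) \<in> segments n"
    using assms E_segments by blast
  then show ?thesis
    using segment_point_spec[of n a E] assms path_sum_eq_sum_set[OF dyck_path_hook[OF ij]]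
    by (auto simp: is_segment_point_def)
qed

lemma chain_with_top_sum_le:
  assumes C: "C \<subseteq> E \<inter> subsegments i j" "Complete_Partial_Order.chain (\<le>) C" "(i, j) \<in> C"
    and nonneg: "\<And>s. s \<in> E \<inter> subsegments i j \<Longrightarrow> s \<noteq> (i, j) \<Longrightarrow> 0 \<le> x\<^sub>E s"
  shows "(\<Sum>s\<in>C. x\<^sub>E s) \<le> weight_sum a i j"
proof -
  have ij: "(i, j) \<in> E" "i < j"
    using C(1,3) E_segments by (auto simp: segments_iff)
  have "C \<subseteq> set (hook i j)"
    using C E_segments by (intro chain_subset_hook) (auto simp: subsegments_def segments_iff)
  moreover have "0 \<le> x\<^sub>E s" if "s \<in> set (hook i j) - C" for s
  proof (cases "s \<in> E")
    case True
    moreover have "s \<noteq> (i, j)"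
      using that C(3) by blast
    ultimately show ?thesis
      using that ij(2) E_segments
      by (intro nonneg) (auto simp: set_hook subsegments_def segments_iff)
  qed (simp add: coord_outside)
  ultimately have "(\<Sum>s\<in>C. x\<^sub>E s) \<le> (\<Sum>s\<in>set (hook i j). x\<^sub>E s)"
    by (intro sum_mono2) auto
  then show ?thesis
    by (simp add: sum_coord_hook[OF ij(1)])
qed

text \<open>Peel off the cells in columns up to \<open>q\<close>, where \<open>(p, q)\<close> is the last cell of the chain in its
  first row. They lie on the hook of \<open>(p, q)\<close>, and the remaining cells come from segments
  beyond \<open>q\<close>.\<close>

lemma chain_sum_less_if_tails_le:
  assumes C: "C \<subseteq> E \<inter> subsegments i j" "Complete_Partial_Order.chain (\<le>) C" "(i, j) \<notin> C" "C \<noteq> {}"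
    and ij: "1 \<le> i" "j \<le> n"
    and nonneg: "\<And>s. s \<in> E \<inter> subsegments i j \<Longrightarrow> s \<noteq> (i, j) \<Longrightarrow> 0 \<le> x\<^sub>E s"
    and tail: "\<And>q D. i < q \<Longrightarrow> q \<le> j \<Longrightarrow> D \<subseteq> C \<inter> subsegments (q + 1) j \<Longrightarrow>
      (\<Sum>s\<in>D. x\<^sub>E s) \<le> weight_sum a (q + 1) j"
  shows "(\<Sum>s\<in>C. x\<^sub>E s) < weight_sum a i j"
proof -
  have "finite C"
    using C(1) E_segments by (intro finite_subset[OF _ finite_segments[of n]]) auto
  moreover have "laminar C"
    using C(1) laminar_E by (auto simp: laminar_def)
  ultimately obtain p q where pq: "(p, q) \<in> C" and first_row: "\<And>s. s \<in> C \<Longrightarrow> p \<le> fst s"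
    and beyond: "\<And>s. s \<in> C \<Longrightarrow> q < snd s \<Longrightarrow> q < fst s"
    using laminar_split C(4) by metis
  have bounds: "i \<le> p" "p < q" "q \<le> j" "(p, q) \<noteq> (i, j)"
    using pq C(1,3) E_segments by (auto simp: subsegments_def segments_iff)
  define left where "left = {s \<in> C. snd s \<le> q}"
  define right where "right = {s \<in> C. q < snd s}"
  have "(\<Sum>s\<in>left. x\<^sub>E s) \<le> weight_sum a p q"
  proof (rule chain_with_top_sum_le)
    show "left \<subseteq> E \<inter> subsegments p q" "(p, q) \<in> left"
      using C(1) first_row pq by (auto simp: left_def subsegments_def)
    show "Complete_Partial_Order.chain (\<le>) left"
      using C(2) by (auto simp: chain_def left_def)
    show "0 \<le> x\<^sub>E s" if "s \<in> E \<inter> subsegments p q" "s \<noteq> (p, q)" for s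
      using that bounds by (intro nonneg) (auto simp: subsegments_def)
  qed
  moreover have "right \<subseteq> C \<inter> subsegments (q + 1) j"
    using C(1) beyond by (force simp: right_def subsegments_def)
  then have "(\<Sum>s\<in>right. x\<^sub>E s) \<le> weight_sum a (q + 1) j"
    using bounds by (intro tail) auto
  moreover have "(\<Sum>s\<in>C. x\<^sub>E s) = (\<Sum>s\<in>left. x\<^sub>E s) + (\<Sum>s\<in>right. x\<^sub>E s)"
    unfolding left_def right_def using \<open>finite C\<close>
    by (subst sum.union_disjoint[symmetric]) (auto intro: sum.cong)
  ultimately show ?thesis
    using weight_sum_remove_less[of i p q j] ij bounds by simp
qed

lemma chain_sum_bound:
  assumes "C \<subseteq> E \<inter> subsegments i j" "Complete_Partial_Order.chain (\<le>) C" "1 \<le> i" "j \<le> n"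
    and "\<And>s. s \<in> E \<inter> subsegments i j \<Longrightarrow> s \<noteq> (i, j) \<Longrightarrow> 0 \<le> x\<^sub>E s"
  shows "(\<Sum>s\<in>C. x\<^sub>E s) \<le> weight_sum a i j
    \<and> (i < j \<longrightarrow> (i, j) \<notin> C \<longrightarrow> (\<Sum>s\<in>C. x\<^sub>E s) < weight_sum a i j)"
  using assms
proof (induction "j - i" arbitrary: i C rule: less_induct)
  case less
  note nonneg = less.prems(5)
  consider "C = {}" | "(i, j) \<in> C" | "C \<noteq> {}" "(i, j) \<notin> C" by blast
  then show ?case
  proof cases
    case 1
    then show ?thesis
      using weight_sum_pos[of i j] less.prems(3,4) by (simp add: sum_nonneg)
  next
    case 2
    then show ?thesis
      using chain_with_top_sum_le[OF less.prems(1,2) _ nonneg] by simp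
  next
    case 3
    have "(\<Sum>s\<in>D. x\<^sub>E s) \<le> weight_sum a (q + 1) j"
      if "i < q" "q \<le> j" and D: "D \<subseteq> C \<inter> subsegments (q + 1) j" for q D
    proof (rule conjunct1[OF less.hyps])
      show "j - (q + 1) < j - i" "1 \<le> q + 1" "j \<le> n"
        using that less.prems(4) by auto
      show "D \<subseteq> E \<inter> subsegments (q + 1) j" "Complete_Partial_Order.chain (\<le>) D"
        using D less.prems(1,2) by (auto simp: chain_def)
      show "0 \<le> x\<^sub>E s" if "s \<in> E \<inter> subsegments (q + 1) j" for s
        using that \<open>i < q\<close> by (intro nonneg) (auto simp: subsegments_def)
    qed
    then show ?thesis
      using chain_sum_less_if_tails_le[OF less.prems(1,2) 3(2,1) less.prems(3,4) nonneg] by simp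
  qed
qed

lemma coord_pos: "(i, j) \<in> E \<Longrightarrow> 0 < x\<^sub>E (i, j)"
proof (induction "j - i" arbitrary: i j rule: less_induct)
  case less
  have ij: "(i, j) \<in> segments n" "1 \<le> i" "i < j" "j \<le> n"
    using less.prems E_segments by (auto simp: segments_iff)
  let ?C = "set (hook i j) \<inter> E - {(i, j)}"
  have chain: "Complete_Partial_Order.chain (\<le>) ?C"
    using dyck_path_chain[OF dyck_path_hook[OF ij(1)]] by (auto simp: chain_def)
  have "0 \<le> x\<^sub>E s" if "s \<in> E \<inter> subsegments i j" "s \<noteq> (i, j)" for s
    using that less.hyps[of "snd s" "fst s"] E_segments
    by (cases s) (force simp: subsegments_def segments_iff)
  then have "(\<Sum>s\<in>?C. x\<^sub>E s) < weight_sum a i j"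
    using chain_sum_bound[OF _ chain ij(2,4)] ij(3) by (force simp: set_hook subsegments_def)
  also have "\<dots> = (\<Sum>s\<in>set (hook i j) \<inter> E. x\<^sub>E s)"
    using sum_coord_hook[OF less.prems] by (simp flip: sum_coord_Int)
  also have "\<dots> = x\<^sub>E (i, j) + (\<Sum>s\<in>?C. x\<^sub>E s)"
  proof (rule sum.remove)
    show "(i, j) \<in> set (hook i j) \<inter> E"
      using less.prems ij(3) by (simp add: set_hook)
  qed simp
  finally show ?case by simp
qed

lemma coord_nonneg: "0 \<le> x\<^sub>E s"
  using coord_pos[of "fst s" "snd s"] coord_outside[of s] by (cases "s \<in> E") auto

lemma path_sum_hook_eq_bound:
  assumes "(i, j) \<in> E"
  shows "path_sum (segment_point n a E) (hook i j) = path_bound a (hook i j)"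
proof -
  have ij: "(i, j) \<in> segments n"
    using assms E_segments by blast
  show ?thesis
    using sum_coord_hook[OF assms]
    by (simp add: path_sum_eq_sum_set[OF dyck_path_hook[OF ij]] path_bound_hook[OF ij])
qed

lemma path_sum_less_or_hook:
  assumes d: "dyck_path n d"
  shows "path_sum (segment_point n a E) d < path_bound a d \<or> (\<exists>(i, j)\<in>E. d = hook i j)"
proof (cases "(fst (hd d), snd (last d)) \<in> set d \<inter> E")
  case True
  then show ?thesis
    using dyck_path_eq_hook[OF d] by blast
next
  case False
  have seg: "(fst (hd d), snd (last d)) \<in> segments n"
    by (rule dyck_path_span_segment[OF d])
  have "set d \<inter> E \<subseteq> E \<inter> subsegments (fst (hd d)) (snd (last d))"
    using hd_le_dyck_path[OF d] dyck_path_le_last[OF d]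
    by (auto simp: subsegments_def less_eq_prod_def)
  moreover have "Complete_Partial_Order.chain (\<le>) (set d \<inter> E)"
    using dyck_path_chain[OF d] by (auto simp: chain_def)
  ultimately have "(\<Sum>s\<in>set d \<inter> E. x\<^sub>E s) < weight_sum a (fst (hd d)) (snd (last d))"
    using chain_sum_bound[of "set d \<inter> E" "fst (hd d)" "snd (last d)"] seg False coord_nonneg
    by (simp add: segments_iff)
  then show ?thesis
    using sum_coord_Int[of "set d"] by (simp add: path_sum_eq_sum_set[OF d] path_bound_eq[OF d])
qed

lemma segment_point_in_FFLV: "segment_point n a E \<in> FFLV n a"
proof -
  have "path_sum (segment_point n a E) d \<le> path_bound a d" if "dyck_path n d" for d
    using path_sum_less_or_hook[OF that] path_sum_hook_eq_bound by fastforce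
  then show ?thesis
    using segment_point_in_coord_space coord_nonneg by (simp add: FFLV_def)
qed

lemma active_constraints_segment_point:
  "active_constraints n a (segment_point n a E) =
    Inl ` (segments n - E) \<union> (\<lambda>(i, j). Inr (hook i j)) ` E"
  (is "?A = ?R")
proof (intro subset_antisym subsetI)
  fix i assume i: "i \<in> ?A"
  show "i \<in> ?R"
  proof (cases i)
    case (Inl s)
    then show ?thesis
      using i coord_pos[of "fst s" "snd s"] by auto
  next
    case (Inr d)
    then show ?thesis
      using i path_sum_less_or_hook[of d] by fastforce
  qed
next
  fix i assume "i \<in> ?R"
  then show "i \<in> ?A"
    using E_segments coord_outside path_sum_hook_eq_bound dyck_path_hook by auto
qed

lemma segment_point_inject:
  assumes F: "F \<subseteq> segments n" "segment_point n a F = segment_point n a E"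
  shows "F = E"
proof
  have spec: "is_segment_point n a F (segment_point n a E)"
    using segment_point_spec[of n a F] F(2) by simp
  show "E \<subseteq> F"
    using spec coord_pos E_segments by (force simp: is_segment_point_def)
  show "F \<subseteq> E"
  proof
    fix s assume s: "s \<in> F"
    obtain i j where ij: "s = (i, j)"
      by fastforce
    have seg: "(i, j) \<in> segments n"
      using s F(1) ij by blast
    have "path_sum (segment_point n a E) (hook i j) = path_bound a (hook i j)"
      using spec s seg by (auto simp: is_segment_point_def ij path_bound_hook)
    then obtain k l where kl: "(k, l) \<in> E" "hook i j = hook k l"
      using path_sum_less_or_hook[OF dyck_path_hook[OF seg]] by auto
    then have "(i, j) = (k, l)"
      using hook_inject[of i j k l] seg E_segments by (auto simp: segments_iff)
    then show "s \<in> E"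
      using kl(1) ij by simp
  qed
qed

end

subsection \<open>The functionals active at a segment point\<close>

definition hook_functional :: "(nat \<times> nat) set \<Rightarrow> nat \<times> nat \<Rightarrow> point \<Rightarrow> real" where
  "hook_functional E s u = (if s \<in> E then - path_sum u (hook (fst s) (snd s)) else coord u s)"

lemma linear_hook_functional: "linear (hook_functional E s)"
  using linear_coord linear_compose_neg[OF linear_path_sum]
  by (cases "s \<in> E") (simp_all add: hook_functional_def[abs_def])

text \<open>Ordered by \<open>j - i\<close>, the functionals are triangular with respect to the coordinates.\<close>

lemma hook_functional_unit_point:
  assumes s: "s \<in> segments n" and t: "t \<in> segments n" and le: "snd t - fst t \<le> snd s - fst s"
  shows "hook_functional E t (unit_point s) = (if s = t then if t \<in> E then - 1 else 1 else 0)"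
proof -
  have "s \<in> set (hook (fst t) (snd t)) \<longleftrightarrow> s = t"
    using s t le by (cases s; cases t) (auto simp: set_hook segments_iff)
  then show ?thesis
    using t dyck_path_hook[of "fst t" "snd t" n]
    by (cases "s = t") (simp_all add: hook_functional_def path_sum_unit_point coord_unit_point)
qed

lemma hook_functional_in_Ints:
  assumes "u \<in> integer_lattice n"
  shows "hook_functional E s u \<in> \<int>"
proof -
  have coord_u: "coord u t \<in> \<int>" for t
    using assms unfolding integer_lattice_def by blast
  have "path_sum u d \<in> \<int>" for d
    by (induction d) (simp_all add: coord_u)
  then show ?thesis
    by (simp add: hook_functional_def coord_u)
qed

lemma hook_functional_prescribe_value:
  assumes u: "u \<in> coord_space n" and s: "s \<in> segments n"
  obtains w where "w \<in> coord_space n" "hook_functional E s w = y"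
    "\<And>t. t \<in> segments n \<Longrightarrow> snd t - fst t \<le> snd s - fst s \<Longrightarrow> t \<noteq> s \<Longrightarrow>
      hook_functional E t w = hook_functional E t u"
    "u \<in> integer_lattice n \<Longrightarrow> y \<in> \<int> \<Longrightarrow> w \<in> integer_lattice n"
proof -
  define r where "r = (if s \<in> E then - 1 else 1) * (y - hook_functional E s u)"
  define w where "w = u + r *\<^sub>R unit_point s"
  have w: "w \<in> coord_space n"
    unfolding w_def using u unit_point_in_coord_space[OF s]
    by (intro subspace_add subspace_scale subspace_coord_space)
  have functional_w:
    "hook_functional E t w = hook_functional E t u + r * hook_functional E t (unit_point s)" for t
    by (simp add: w_def linear_add[OF linear_hook_functional] linear_scale[OF linear_hook_functional])
  have "w \<in> integer_lattice n" if "u \<in> integer_lattice n" "y \<in> \<int>"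
  proof -
    have "r \<in> \<int>"
      using that hook_functional_in_Ints[of u n E s] by (simp add: r_def)
    then show ?thesis
      using w that(1) by (simp add: w_def integer_lattice_def lookup_add coord_unit_point)
  qed
  then show thesis
    using w s by (intro that[of w]) (simp_all add: functional_w hook_functional_unit_point r_def)
qed

lemma hook_functional_solution_exists:
  assumes "S \<subseteq> segments n"
  shows "\<exists>u\<in>coord_space n. (\<forall>s\<in>S. hook_functional E s u = f s)
    \<and> ((\<forall>s\<in>S. f s \<in> \<int>) \<longrightarrow> u \<in> integer_lattice n)"
proof -
  have "finite S"
    by (rule finite_subset[OF assms finite_segments])
  then show ?thesis
    using assms
  proof (induction S rule: finite_ranking_induct[where f = "\<lambda>s. snd s - fst s"])
    case empty
    have "0 \<in> coord_space n" "0 \<in> integer_lattice n"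
      by (simp_all add: coord_space_iff integer_lattice_def)
    then show ?case by blast
  next
    case (insert s S)
    then obtain u where u: "u \<in> coord_space n" "\<forall>t\<in>S. hook_functional E t u = f t"
      "(\<forall>t\<in>S. f t \<in> \<int>) \<longrightarrow> u \<in> integer_lattice n"
      by blast
    have "s \<in> segments n" "S \<subseteq> segments n"
      using insert.prems by simp_all
    then obtain w where "w \<in> coord_space n" "hook_functional E s w = f s"
      "\<And>t. t \<in> S \<Longrightarrow> t \<noteq> s \<Longrightarrow> hook_functional E t w = hook_functional E t u"
      "u \<in> integer_lattice n \<Longrightarrow> f s \<in> \<int> \<Longrightarrow> w \<in> integer_lattice n"
      using hook_functional_prescribe_value[OF u(1), of s E "f s"] insert.hyps(2) by (metis subsetD)
    then show ?case
      using u(2,3) by (intro bexI[of _ w]) auto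
  qed
qed

lemma hook_functionals_separate:
  assumes u: "u \<in> coord_space n" and zero: "\<And>s. s \<in> segments n \<Longrightarrow> hook_functional E s u = 0"
  shows "u = 0"
proof (rule poly_mapping_eqI)
  have "coord u (i, j) = 0" if "(i, j) \<in> segments n" for i j
    using that
  proof (induction "j - i" arbitrary: i j rule: less_induct)
    case less
    have "coord u s = 0" if s: "s \<in> set (hook i j) - {(i, j)}" for s
    proof -
      have "coord u (fst s, snd s) = 0"
        using s less.prems by (intro less.hyps) (auto simp: set_hook segments_iff prod_eq_iff)
      then show ?thesis by simp
    qed
    moreover have "(i, j) \<in> set (hook i j)"
      using less.prems by (simp add: set_hook segments_iff)
    ultimately have "path_sum u (hook i j) = (\<Sum>s\<in>{(i, j)}. coord u s)"
      unfolding path_sum_eq_sum_set[OF dyck_path_hook[OF less.prems]]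
      by (intro sum.mono_neutral_right) simp_all
    then show ?case
      using zero[OF less.prems] by (simp add: hook_functional_def split: if_splits)
  qed
  then show "coord u s = coord 0 s" for s
    using u by (cases s, cases "s \<in> segments n") (simp_all add: coord_space_iff)
qed

lemma integer_lattice_eq_hook_functionals:
  "integer_lattice n = {u \<in> coord_space n. \<forall>s\<in>segments n. hook_functional E s u \<in> \<int>}"
proof (intro subset_antisym subsetI)
  fix u assume "u \<in> integer_lattice n"
  then show "u \<in> {u \<in> coord_space n. \<forall>s\<in>segments n. hook_functional E s u \<in> \<int>}"
    using hook_functional_in_Ints by (auto simp: integer_lattice_def)
next
  fix u assume u: "u \<in> {u \<in> coord_space n. \<forall>s\<in>segments n. hook_functional E s u \<in> \<int>}"
  then obtain w where w: "w \<in> coord_space n"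
    "\<forall>s\<in>segments n. hook_functional E s w = hook_functional E s u"
    "w \<in> integer_lattice n"
    using hook_functional_solution_exists[OF subset_refl, of n E "\<lambda>s. hook_functional E s u"]
    by blast
  have "u - w = 0"
    using u w(1,2) subspace_diff[OF subspace_coord_space]
    by (intro hook_functionals_separate[of _ n E])
      (auto simp: linear_diff[OF linear_hook_functional])
  then show "u \<in> integer_lattice n"
    using w(3) by simp
qed

lemma unimodular_hook_cone:
  "unimodular_cone (integer_lattice n)
    {u \<in> coord_space n. \<forall>s\<in>segments n. 0 \<le> hook_functional E s u}"
proof -
  have "\<exists>u. u \<in> coord_space n \<and> (\<forall>t\<in>segments n. hook_functional E t u = of_bool (s = t))" for s
    using hook_functional_solution_exists[OF subset_refl, of n E "\<lambda>t. of_bool (s = t)"] by blast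
  then obtain b where b: "\<And>s. b s \<in> coord_space n"
    "\<And>s t. t \<in> segments n \<Longrightarrow> hook_functional E t (b s) = of_bool (s = t)"
    by metis
  interpret dual_basis "coord_space n" "segments n" "hook_functional E" b
    by (rule dual_basis.intro)
      (use b subspace_coord_space linear_hook_functional hook_functionals_separate
        in \<open>blast | simp\<close>)+
  show ?thesis
    using unimodular_nonneg_cone by (simp flip: integer_lattice_eq_hook_functionals)
qed

lemma (in laminar_segments) simple_vertex_segment_point:
  "simple_vertex (integer_lattice n) (FFLV n a) (segment_point n a E)"
proof -
  have "(\<forall>s\<in>segments n. Q s) \<longleftrightarrow> (\<forall>s\<in>segments n - E. Q s) \<and> (\<forall>s\<in>E. Q s)" for Q
    using E_segments by blast
  then have "(\<forall>i\<in>active_constraints n a (segment_point n a E). 0 \<le> constraint_fun i u)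
      \<longleftrightarrow> (\<forall>s\<in>segments n. 0 \<le> hook_functional E s u)" for u
    by (simp add: active_constraints_segment_point hook_functional_def ball_Un case_prod_beta)
  then show ?thesis
    using unimodular_hook_cone[of n E]
    by (simp add: simple_vertex_iff segment_point_in_FFLV tangent_cone_FFLV)
qed

lemma laminar_iff_meeting_segments_nested:
  assumes "E \<subseteq> segments n"
  shows "laminar E \<longleftrightarrow> (\<forall>s \<in> E. \<forall>t \<in> E. segment s \<inter> segment t \<noteq> {} \<longrightarrow>
               segment s \<inter> segment t = segment s \<or> segment s \<inter> segment t = segment t)"
    (is "_ \<longleftrightarrow> ?nested")
proof
  assume lam: "laminar E"
  show ?nested
  proof (intro ballI impI)
    fix s t assume s: "s \<in> E" and t: "t \<in> E" and "segment s \<inter> segment t \<noteq> {}"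
    then have "fst t \<le> snd s" "fst s \<le> snd t"
      by (auto simp: segment_def)
    then have "snd t \<le> snd s \<and> fst s \<le> fst t \<or> snd s \<le> snd t \<and> fst t \<le> fst s"
      using lam s t unfolding laminar_def
      by (metis linorder_neqE_nat nat_le_linear order.refl less_imp_le)
    then show "segment s \<inter> segment t = segment s \<or> segment s \<inter> segment t = segment t"
      by (auto simp: segment_def)
  qed
next
  assume nested: ?nested
  show "laminar E"
    unfolding laminar_def
  proof (intro ballI impI)
    fix s t assume s: "s \<in> E" and t: "t \<in> E" and lt: "fst s < fst t" and le: "fst t \<le> snd s"
    have "fst s < snd s" "fst t < snd t"
      using assms s t by (auto simp: segments_iff)
    then have ends: "real (fst t) \<in> segment s \<inter> segment t" "real (fst s) \<in> segment s"
      "real (fst s) \<notin> segment t" "real (snd t) \<in> segment t"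
      using lt le by (auto simp: segment_def)
    then have "segment s \<inter> segment t = segment t"
      using nested s t by blast
    then have "real (snd t) \<in> segment s"
      using ends(4) by blast
    then show "snd t \<le> snd s"
      by (simp add: segment_def)
  qed
qed

lemma (in regular_weight) simple_vertex_segment_point_iff:
  assumes E: "E \<subseteq> segments n"
  shows "simple_vertex (integer_lattice n) (FFLV n a) (segment_point n a E) \<longleftrightarrow> laminar E"
proof
  assume "simple_vertex (integer_lattice n) (FFLV n a) (segment_point n a E)"
  then obtain F where F: "F \<subseteq> segments n" "laminar F" "segment_point n a E = segment_point n a F"
    by (rule simple_vertex_imp_laminar_segment_point)
  interpret laminar_segments n a F
    using F(1,2) by unfold_locales
  show "laminar E"
    using segment_point_inject[OF E F(3)] F(2) by simp
next
  assume "laminar E"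
  then interpret laminar_segments n a E
    using E by unfold_locales
  show "simple_vertex (integer_lattice n) (FFLV n a) (segment_point n a E)"
    by (rule simple_vertex_segment_point)
qed

theorem theorem1p4:
  fixes n :: nat and a :: "nat \<Rightarrow> nat"
  assumes "n \<ge> 2"
    and "\<And>i. i \<in> {1..n - 1} \<Longrightarrow> a i > 0"
  shows "(\<forall>v. simple_vertex (integer_lattice n) (FFLV n a) v \<longrightarrow>
            (\<exists>E \<subseteq> segments n. v = segment_point n a E)) \<and>
         (\<forall>E \<subseteq> segments n.
            simple_vertex (integer_lattice n) (FFLV n a) (segment_point n a E) \<longleftrightarrow>
            (\<forall>s \<in> E. \<forall>t \<in> E. segment s \<inter> segment t \<noteq> {} \<longrightarrow>
               segment s \<inter> segment t = segment s \<or> segment s \<inter> segment t = segment t))"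
proof -
  interpret regular_weight n a
    by unfold_locales (rule assms(2))
  show ?thesis
  proof (intro conjI allI impI)
    fix v assume "simple_vertex (integer_lattice n) (FFLV n a) v"
    then show "\<exists>E \<subseteq> segments n. v = segment_point n a E"
      using simple_vertex_imp_laminar_segment_point by blast
  qed (simp add: simple_vertex_segment_point_iff laminar_iff_meeting_segments_nested)
qed

end
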